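(* Let $\Theta$, $f_1,\dots,f_m$, $w\in\Delta_m$, $\mathrm{TCH}(\cdot\,;w)$, the constants $U,L,R_\theta$ and the stochastic gradients be as in the context; in particular each $f_i$ is convex with $f_i\le U$ and $\|\nabla f_i\|_\infty\le L$ on $\Theta$, and $\|\theta\|_\infty\le R_\theta$ for all $\theta\in\Theta$. Use projected gradient descent (PGD) for $\theta$ and exponentiated gradient (EG) for $\lambda$, i.e. online mirror descent with $\psi_\theta=\frac12\|\cdot\|_2^2$ and $\psi_\lambda(\lambda)=\sum_i\lambda_i\log\lambda_i$. Then the associated constants (defined in the context) can be taken as $\mu_\theta=\mu_\lambda=1$, $D_\theta=2dR_\theta^2$, $D_\lambda=\log m$, $C_\theta=d$, $C_\lambda=1$. Consequently, with step sizes $\eta_\theta=\sqrt{\frac{8R_\theta^2}{5TL^2}}$ and $\eta_\lambda=\sqrt{\frac{4\log m}{5TU^2}}$, for $\hat\theta$ either the uniformly averaged output $\bar\theta$ or the adaptively averaged output $\tilde\theta$, and for every $0<\gamma<1$, with probability at least $1-\gamma$, $$\mathrm{TCH}(\hat\theta;w)-\min_{\theta\in\Theta}\mathrm{TCH}(\theta;w)\le\frac{2\sqrt{10}\,dR_\theta L}{\sqrt T}+\frac{2\sqrt5\sqrt{\log m}\,U}{\sqrt T}+4(dR_\theta L+U)\sqrt{\frac2T\log\frac1\gamma}.$$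
   Context: Problem. $d,m,T\ge1$ are integers, $\Delta_m=\{\alpha\in\mathbb{R}^m:\sum_i\alpha_i=1,\ \alpha_i\ge0\}$. $\Theta\subset\mathbb{R}^d$ is nonempty, closed and convex; $f_1,\dots,f_m:\mathbb{R}^d\to\mathbb{R}$ are differentiable and nonnegative on $\Theta$. For $w\in\Delta_m$, $\mathrm{TCH}(\theta;w)=\max_{i\in[m]}w_if_i(\theta)$ and $\mathcal{L}(\theta,\lambda;w)=\sum_{i=1}^m\lambda_iw_if_i(\theta)$ for $\lambda\in\Delta_m$. Assumption. There are constants $U,L,R_\theta>0$ such that for all $i\in[m]$ and $\theta\in\Theta$: $f_i$ is convex on $\Theta$, $f_i(\theta)\le U$, $\|\nabla f_i(\theta)\|_\infty\le L$, $\|\theta\|_\infty\le R_\theta$. Stochastic gradients. In each round $t$, for each objective $i$ a random batch of its training data is drawn (fresh in each round), giving random estimates $\delta f_i(\theta^{(t)})\in\mathbb{R}^d$ of $\nabla f_i(\theta^{(t)})$ and $\hat f_i^{(t)}\in\mathbb{R}$ of $f_i(\theta^{(t)})$ (batch averages of per-sample gradients and losses), whose conditional expectations given all batches of rounds $1,\dots,t-1$ are $\nabla f_i(\theta^{(t)})$ and $f_i(\theta^{(t)})$. Put $g_\theta^{(t)}=\sum_i\lambda_i^{(t)}w_i\,\delta f_i(\theta^{(t)})$ and $g_\lambda^{(t)}=(w_i\hat f_i^{(t)})_{i=1}^m$; these are conditionally unbiased for $\nabla_\theta\mathcal{L}(\theta^{(t)},\lambda^{(t)};w)$ and $\nabla_\lambda\mathcal{L}(\theta^{(t)},\lambda^{(t)};w)$,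 and $\|g_\theta^{(t)}\|_\infty\le L$, $\|g_\lambda^{(t)}\|_\infty\le U$. Updates (PGD/EG). With $\Pi_\Theta$ the Euclidean projection onto $\Theta$, a deterministic $\theta^{(1)}\in\Theta$ and $\lambda^{(1)}=(1/m,\dots,1/m)$, for $t=1,\dots,T$: $\theta^{(t+1)}=\Pi_\Theta(\theta^{(t)}-\eta_\theta g_\theta^{(t)})$ and $\lambda_i^{(t+1)}=\dfrac{\lambda_i^{(t)}\exp(\eta_\lambda (g_\lambda^{(t)})_i)}{\sum_{j=1}^m\lambda_j^{(t)}\exp(\eta_\lambda (g_\lambda^{(t)})_j)}$. Outputs. The uniform conversion (OMD-TCH) outputs $\bar\theta=\frac1T\sum_{t=1}^T\theta^{(t)}$. Adaptive conversion (AdaOMD-TCH): say $\theta\preceq\theta'$ ($\theta$ dominates $\theta'$) if $f_i(\theta)\le f_i(\theta')$ for all $i$ and $f_j(\theta)<f_j(\theta')$ for some $j$. Maintain a set $P^{(t)}$ of iterates with weights $\gamma^{(t)}$, starting from $P^{(0)}=\emptyset$. In round $t$ let $A=\{\theta^{(\tau)}\in P^{(t-1)}:\theta^{(\tau)}\preceq\theta^{(t)}\}$. If $A\neq\emptyset$, keep $P^{(t)}=P^{(t-1)}$ and the weights, except that each element of $A$ has its weight increased by $1/|A|$. If $A=\emptyset$, let $B=\{\theta^{(\tau)}\in P^{(t-1)}:\theta^{(t)}\preceq\theta^{(\tau)}\}$, remove $B$ from the set, and add $\theta^{(t)}$ with weight $1$ plus the sum of the weights of the elements of $B$. Iterates are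 indexed by their round, and dominance uses the true objectives. The output is $\tilde\theta=\frac1T\sum_{\theta^{(\tau)}\in P^{(T)}}\gamma_\tau^{(T)}\theta^{(\tau)}$. Associated constants. $B_\psi(x;y)=\psi(x)-\psi(y)-\langle\nabla\psi(y),x-y\rangle$ (for $\psi_\lambda$, $y$ has positive entries and $0\log0=0$). $\mu_\theta$ is a strong convexity constant of $\psi_\theta$ with respect to $\|\cdot\|_2$ (dual norm $\|\cdot\|_2$), and $\mu_\lambda$ is a strong convexity constant of $\psi_\lambda$ on $\Delta_m$ with respect to $\|\cdot\|_1$ (dual norm $\|\cdot\|_\infty$). With $\bar\lambda=\frac1T\sum_t\lambda^{(t)}$, $\theta^*\in\arg\min_{\theta\in\Theta}\mathcal{L}(\theta,\bar\lambda;w)$ and $\lambda^*\in\arg\max_{\lambda\in\Delta_m}\mathcal{L}(\hat\theta,\lambda;w)$, the constants must satisfy $B_{\psi_\theta}(\theta^*;\theta^{(1)})\le D_\theta$, $B_{\psi_\lambda}(\lambda^*;\lambda^{(1)})\le D_\lambda$, and for all $t$, $\|\cdot\|_2^2\le C_\theta L^2$ for both $\nabla_\theta\mathcal{L}(\theta^{(t)},\lambda^{(t)};w)$ and $g_\theta^{(t)}$, and $\|\cdot\|_\infty^2\le C_\lambda U^2$ for both $\nabla_\lambda\mathcal{L}(\theta^{(t)},\lambda^{(t)};w)$ and $g_\lambda^{(t)}$. *)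

theory Defs
  imports "HOL-Probability.Probability"
begin

definition prob_simplex :: "(real^'m) set" where
  "prob_simplex = {\<alpha>. (\<Sum>i\<in>UNIV. \<alpha> $ i) = 1 \<and> (\<forall>i. 0 \<le> \<alpha> $ i)}"

definition TCH :: "('m::finite \<Rightarrow> real^'d \<Rightarrow> real) \<Rightarrow> real^'m \<Rightarrow> real^'d \<Rightarrow> real" where
  "TCH f w \<theta> = Max (range (\<lambda>i. w $ i * f i \<theta>))"

definition Lag :: "('m::finite \<Rightarrow> real^'d \<Rightarrow> real) \<Rightarrow> real^'m \<Rightarrow> real^'d \<Rightarrow> real^'m \<Rightarrow> real" where
  "Lag f w \<theta> l = (\<Sum>i\<in>UNIV. l $ i * w $ i * f i \<theta>)"

text \<open>The gradient is only meaningful where the function is (Frechet) differentiable on a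
  full neighbourhood of the point; there it is unique.\<close>

definition grad :: "('a::euclidean_space \<Rightarrow> real) \<Rightarrow> 'a \<Rightarrow> 'a" where
  "grad h x = (THE D. GDERIV h x :> D)"

definition norm_L1 :: "real^'m \<Rightarrow> real" where
  "norm_L1 x = (\<Sum>i\<in>UNIV. \<bar>x $ i\<bar>)"

definition bregman :: "('a::euclidean_space \<Rightarrow> real) \<Rightarrow> 'a \<Rightarrow> 'a \<Rightarrow> real" where
  "bregman \<psi> x y = \<psi> x - \<psi> y - grad \<psi> y \<bullet> (x - y)"

text \<open>Strong convexity of \<open>\<psi>\<close> on \<open>S\<close> with constant \<open>\<mu>\<close>, with respect to the norm \<open>N\<close>. This form
  needs no derivative, hence also makes sense for the negative entropy on the boundary of the
  simplex.\<close>

definition strongly_convex_on ::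
    "('a::real_vector) set \<Rightarrow> ('a \<Rightarrow> real) \<Rightarrow> real \<Rightarrow> ('a \<Rightarrow> real) \<Rightarrow> bool" where
  "strongly_convex_on S N \<mu> \<psi> \<longleftrightarrow> convex S \<and> 0 < \<mu> \<and>
     (\<forall>x\<in>S. \<forall>y\<in>S. \<forall>a\<in>{0..1}.
        \<psi> (a *\<^sub>R x + (1 - a) *\<^sub>R y)
          \<le> a * \<psi> x + (1 - a) * \<psi> y - \<mu> / 2 * a * (1 - a) * (N (x - y))\<^sup>2)"

definition psi_PGD :: "real^'d \<Rightarrow> real" where
  "psi_PGD x = (norm x)\<^sup>2 / 2"

text \<open>The convention \<open>0 log 0 = 0\<close> holds here because of the factor \<open>0\<close>.\<close>

definition psi_EG :: "real^'m \<Rightarrow> real" where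
  "psi_EG x = (\<Sum>i\<in>UNIV. x $ i * ln (x $ i))"

definition est_grad_theta ::
    "real^'m \<Rightarrow> real^'m \<Rightarrow> ('m::finite \<Rightarrow> real^'d) \<Rightarrow> real^'d" where
  "est_grad_theta w l \<delta>f = (\<Sum>i\<in>UNIV. (l $ i * w $ i) *\<^sub>R \<delta>f i)"

definition est_grad_lambda :: "real^'m \<Rightarrow> ('m::finite \<Rightarrow> real) \<Rightarrow> real^'m" where
  "est_grad_lambda w fh = (\<chi> i. w $ i * fh i)"

definition PGD_step :: "(real^'d) set \<Rightarrow> real \<Rightarrow> real^'d \<Rightarrow> real^'d \<Rightarrow> real^'d" where
  "PGD_step \<Theta> \<eta> \<theta> g = closest_point \<Theta> (\<theta> - \<eta> *\<^sub>R g)"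

definition EG_step :: "real \<Rightarrow> real^'m \<Rightarrow> real^'m \<Rightarrow> real^'m" where
  "EG_step \<eta> l g =
     (\<chi> i. l $ i * exp (\<eta> * g $ i) / (\<Sum>j\<in>UNIV. l $ j * exp (\<eta> * g $ j)))"

text \<open>Information available after round \<open>n\<close>: the sigma-algebra generated by the batches
  \<open>batch s i\<close> of the rounds \<open>s = 1, \<dots>, n\<close> (trivial for \<open>n = 0\<close>).\<close>

definition batch_history ::
    "'w measure \<Rightarrow> ('m \<Rightarrow> 'b measure) \<Rightarrow> (nat \<Rightarrow> 'm \<Rightarrow> 'w \<Rightarrow> 'b) \<Rightarrow> nat \<Rightarrow> 'w measure" where
  "batch_history M Z batch n =
     sigma (space M)
       {batch s i -` A \<inter> space M | s i A. s \<in> {1..n} \<and> A \<in> sets (Z i)}"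

definition time_average :: "nat \<Rightarrow> (nat \<Rightarrow> 'a::real_vector) \<Rightarrow> 'a" where
  "time_average T x = (1 / real T) *\<^sub>R (\<Sum>t=1..T. x t)"

definition dominates :: "('m \<Rightarrow> 'a \<Rightarrow> real) \<Rightarrow> 'a \<Rightarrow> 'a \<Rightarrow> bool" where
  "dominates f x y \<longleftrightarrow> (\<forall>i. f i x \<le> f i y) \<and> (\<exists>j. f j x < f j y)"

text \<open>State \<open>(P, \<gamma>)\<close> of the adaptive conversion after a given round; \<open>P\<close> holds the round indices of
  the maintained iterates, and \<open>\<gamma>\<close> is only meaningful on \<open>P\<close>.\<close>

primrec ada_state ::
    "('m \<Rightarrow> 'a \<Rightarrow> real) \<Rightarrow> (nat \<Rightarrow> 'a) \<Rightarrow> nat \<Rightarrow> nat set \<times> (nat \<Rightarrow> real)" where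
  "ada_state f \<theta> 0 = ({}, \<lambda>_. 0)"
| "ada_state f \<theta> (Suc n) =
     (let (P, \<gamma>) = ada_state f \<theta> n;
          t = Suc n;
          A = {\<tau>\<in>P. dominates f (\<theta> \<tau>) (\<theta> t)};
          B = {\<tau>\<in>P. dominates f (\<theta> t) (\<theta> \<tau>)}
      in if A \<noteq> {}
         then (P, \<lambda>\<tau>. if \<tau> \<in> A then \<gamma> \<tau> + 1 / real (card A) else \<gamma> \<tau>)
         else (insert t (P - B), \<gamma>(t := 1 + sum \<gamma> B)))"

definition ada_average ::
    "('m \<Rightarrow> 'a \<Rightarrow> real) \<Rightarrow> nat \<Rightarrow> (nat \<Rightarrow> 'a::real_vector) \<Rightarrow> 'a" where
  "ada_average f T \<theta> =
     (let (P, \<gamma>) = ada_state f \<theta> T in (1 / real T) *\<^sub>R (\<Sum>\<tau>\<in>P. \<gamma> \<tau> *\<^sub>R \<theta> \<tau>))"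

text \<open>For one realised trajectory \<open>\<theta>, l\<close> with stochastic gradients \<open>g\<theta>, gl\<close> and output \<open>\<theta>hat\<close>:
  the listed numbers are admissible strong convexity constants, divergence bounds and gradient
  constants. The dual norms are the Euclidean norm and \<open>infnorm\<close>.\<close>

definition associated_constants ::
    "(real^'d) set \<Rightarrow> ('m::finite \<Rightarrow> real^'d \<Rightarrow> real) \<Rightarrow> real^'m \<Rightarrow> real \<Rightarrow> real \<Rightarrow> nat \<Rightarrow>
     (real^'d \<Rightarrow> real) \<Rightarrow> (real^'m \<Rightarrow> real) \<Rightarrow>
     (nat \<Rightarrow> real^'d) \<Rightarrow> (nat \<Rightarrow> real^'m) \<Rightarrow> (nat \<Rightarrow> real^'d) \<Rightarrow> (nat \<Rightarrow> real^'m) \<Rightarrow> real^'d \<Rightarrow>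
     real \<Rightarrow> real \<Rightarrow> real \<Rightarrow> real \<Rightarrow> real \<Rightarrow> real \<Rightarrow> bool" where
  "associated_constants \<Theta> f w U L T \<psi>\<theta> \<psi>l \<theta> l g\<theta> gl \<theta>hat \<mu>\<theta> \<mu>l D\<theta> Dl C\<theta> Cl \<longleftrightarrow>
     strongly_convex_on UNIV norm \<mu>\<theta> \<psi>\<theta> \<and>
     strongly_convex_on prob_simplex norm_L1 \<mu>l \<psi>l \<and>
     (\<forall>\<theta>s. is_arg_min (\<lambda>x. Lag f w x (time_average T l)) (\<lambda>x. x \<in> \<Theta>) \<theta>s
        \<longrightarrow> bregman \<psi>\<theta> \<theta>s (\<theta> 1) \<le> D\<theta>) \<and>
     (\<forall>ls. is_arg_max (\<lambda>y. Lag f w \<theta>hat y) (\<lambda>y. y \<in> prob_simplex) ls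
        \<longrightarrow> bregman \<psi>l ls (l 1) \<le> Dl) \<and>
     (\<forall>t\<in>{1..T}.
        (norm (grad (\<lambda>x. Lag f w x (l t)) (\<theta> t)))\<^sup>2 \<le> C\<theta> * L\<^sup>2 \<and>
        (norm (g\<theta> t))\<^sup>2 \<le> C\<theta> * L\<^sup>2 \<and>
        (infnorm (grad (\<lambda>y. Lag f w (\<theta> t) y) (l t)))\<^sup>2 \<le> Cl * U\<^sup>2 \<and>
        (infnorm (gl t))\<^sup>2 \<le> Cl * U\<^sup>2)"

end

theory Submission
  imports Defs
begin

text \<open>The primal-dual gap of the output is at most the average over the rounds of
  \<open>\<nabla>\<^sub>\<theta> \<bullet> (\<theta>\<^sub>t - y) + \<nabla>\<^sub>\<lambda> \<bullet> (e\<^sub>i - \<lambda>\<^sub>t)\<close>, where \<open>y\<close> is any feasible point and \<open>e\<^sub>i\<close> the vertex of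
  the simplex attaining \<open>TCH\<close>. Replacing the gradients by their estimates leaves the regrets of PGD
  and EG, plus noise terms whose comparator \<open>e\<^sub>i\<close> depends on the trajectory. Ghost iterates, which
  run PGD and EG on the noise itself, absorb this comparator at the price of two more regrets; what
  remains is a bounded martingale difference sequence, controlled by the Azuma-Hoeffding inequality.
  The noise is at most twice as large as the gradients, which turns the second-order term \<open>1/2\<close> of
  the regret into \<open>(1 + 4)/2 = 5/2\<close> and explains the constant \<open>5\<close> in the step sizes.\<close>

section \<open>Gradients, relative entropy and Pinsker's inequality\<close>

text \<open>Azuma-Hoeffding needs noise terms that are a factor known before the round times a
  centred estimate. The vertex e_i is chosen from the final output, so its product with the noise is
  no martingale difference. A ghost is built from earlier rounds only, and its regret bound holds
  for every comparator. As y leaves the noise too, one event serves all feasible y, and the infimum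
  can be taken on it. With d, R, L, U, m as in the statement, two regrets per player give 8dR^2 +
  5\<eta>^2 T d L^2 for \<theta>, before division by 2\<eta>, and 2 ln m + 5\<eta>^2 T U^2 / 2 for
  \<lambda>, before division by \<eta>. The step sizes equalise the two summands of each, whence 2
  sqrt 10 and 2 sqrt 5. A noise term is at most 2L times 2dR plus 2U times 2, which is c = 4(dRL +
  U); the level c sqrt (2T ln (1/\<gamma>)), divided by T, is the last summand. Measurability shapes
  the rest: the ghosts are driven by conditional expectations, which agree with the exact gradients
  only almost surely, and the adaptive output depends discontinuously on the trajectory.\<close>

lemma grad_eqI:
  assumes "GDERIV h x :> D"
  shows "grad h x = D"
  unfolding grad_def
proof (rule the_equality)
  fix D' assume "GDERIV h x :> D'"
  then have "(\<lambda>k. k \<bullet> D') = (\<lambda>k. k \<bullet> D)"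
    using assms has_derivative_unique unfolding gderiv_def by blast
  then show "D' = D"
    by (metis inner_eq_zero_iff inner_diff_right right_minus_eq)
qed (fact assms)

text \<open>The derivative is a linear functional, and its values on the basis are the coordinates
  of the representing vector. This licenses the definite description in \<open>grad\<close> at
  points of differentiability.\<close>

lemma GDERIV_grad:
  assumes "h differentiable (at x)"
  shows "GDERIV h x :> grad h x"
proof -
  obtain h' where h': "(h has_derivative h') (at x)"
    using assms by (auto simp: differentiable_def)
  interpret bounded_linear h' using h' by (rule has_derivative_bounded_linear)
  have "h' = (\<lambda>k. k \<bullet> (\<Sum>b\<in>Basis. h' b *\<^sub>R b))"
  proof
    fix k
    have "h' k = h' (\<Sum>b\<in>Basis. (k \<bullet> b) *\<^sub>R b)" by (simp add: euclidean_representation)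
    also have "\<dots> = (\<Sum>b\<in>Basis. (k \<bullet> b) * h' b)" by (simp add: sum scaleR)
    also have "\<dots> = k \<bullet> (\<Sum>b\<in>Basis. h' b *\<^sub>R b)" by (simp add: inner_sum_right mult.commute)
    finally show "h' k = k \<bullet> (\<Sum>b\<in>Basis. h' b *\<^sub>R b)" .
  qed
  with h' have "GDERIV h x :> (\<Sum>b\<in>Basis. h' b *\<^sub>R b)" by (simp add: gderiv_def)
  then show ?thesis using grad_eqI by metis
qed

text \<open>Convexity is known on S only, while the derivative is taken in the whole space. On the
  segment from x to y both apply: the right difference quotients at x are at most the chord slope h
  y - h x, and they tend to the directional derivative.\<close>

lemma convex_on_above_tangent:
  fixes h :: "'a::real_inner \<Rightarrow> real"
  assumes conv: "convex_on S h" and xy: "x \<in> S" "y \<in> S" and D: "GDERIV h x :> D"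
  shows "h x + D \<bullet> (y - x) \<le> h y"
proof -
  have line: "((\<lambda>t::real. x + t *\<^sub>R (y - x)) has_derivative (\<lambda>t. t *\<^sub>R (y - x))) (at 0)"
    by (auto intro!: derivative_eq_intros)
  have "((\<lambda>t::real. h (x + t *\<^sub>R (y - x))) has_derivative (\<lambda>t. (t *\<^sub>R (y - x)) \<bullet> D)) (at 0)"
    using has_derivative_compose[OF line, of h "\<lambda>k. k \<bullet> D"] D by (simp add: gderiv_def)
  then have "((\<lambda>t::real. h (x + t *\<^sub>R (y - x))) has_real_derivative (D \<bullet> (y - x))) (at 0)"
    by (simp add: has_field_derivative_def mult_commute_abs inner_commute)
  then have "(\<lambda>t. (h (x + t *\<^sub>R (y - x)) - h x) / t) \<midarrow>0\<rightarrow> D \<bullet> (y - x)"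
    by (simp add: has_field_derivative_iff)
  then have lim: "((\<lambda>t. (h (x + t *\<^sub>R (y - x)) - h x) / t) \<longlongrightarrow> D \<bullet> (y - x)) (at_right 0)"
    by (rule tendsto_mono[rotated]) (rule at_le, simp)
  have "\<forall>\<^sub>F t in at_right 0. (h (x + t *\<^sub>R (y - x)) - h x) / t \<le> h y - h x"
  proof -
    have "\<forall>\<^sub>F t::real in at_right 0. 0 < t \<and> t < 1"
      by (auto simp: eventually_at_right_field intro: exI[of _ 1])
    then show ?thesis
    proof eventually_elim
      case (elim t)
      have "h ((1 - t) *\<^sub>R x + t *\<^sub>R y) \<le> (1 - t) * h x + t * h y"
        using conv xy elim by (intro convex_onD) auto
      moreover have "(1 - t) *\<^sub>R x + t *\<^sub>R y = x + t *\<^sub>R (y - x)" by (simp add: algebra_simps)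
      ultimately show ?case using elim by (simp add: field_simps)
    qed
  qed
  with lim have "D \<bullet> (y - x) \<le> h y - h x"
    by (rule tendsto_upperbound) simp
  then show ?thesis by simp
qed

lemma GDERIV_sum:
  assumes "\<And>i. i \<in> A \<Longrightarrow> GDERIV (g i) x :> D i"
  shows "GDERIV (\<lambda>x. \<Sum>i\<in>A. g i x) x :> (\<Sum>i\<in>A. D i)"
  using assms unfolding gderiv_def inner_sum_right by (intro has_derivative_sum) auto

lemma GDERIV_cmult:
  fixes c :: real
  assumes "GDERIV g x :> D"
  shows "GDERIV (\<lambda>x. c * g x) x :> c *\<^sub>R D"
  using GDERIV_mult[OF GDERIV_const assms, of c] by simp

lemma inner_axis_one [simp]: "inner x (axis i (1::real)) = x $ i"
  by (simp add: inner_axis)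

lemma GDERIV_component: "GDERIV (\<lambda>x::real^'m. x $ i) x :> axis i 1"
  unfolding gderiv_def by (simp add: bounded_linear_imp_has_derivative bounded_linear_vec_nth)

lemma grad_Lag_theta:
  assumes "\<And>i. f i differentiable (at x)"
  shows "grad (\<lambda>x. Lag f w x l) x = (\<Sum>i\<in>UNIV. (l $ i * w $ i) *\<^sub>R grad (f i) x)"
  unfolding Lag_def
  by (intro grad_eqI GDERIV_sum GDERIV_cmult GDERIV_grad assms)

lemma grad_Lag_lambda: "grad (\<lambda>y. Lag f w x y) l = (\<chi> i. w $ i * f i x)"
proof -
  have "GDERIV (\<lambda>y. \<Sum>i\<in>UNIV. (w $ i * f i x) * y $ i) l :> (\<Sum>i\<in>UNIV. (w $ i * f i x) *\<^sub>R axis i 1)"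
    by (intro GDERIV_sum GDERIV_cmult GDERIV_component)
  moreover have "(\<Sum>i\<in>UNIV. (w $ i * f i x) *\<^sub>R axis i 1) = (\<chi> i. w $ i * f i x)"
    using basis_expansion[of "\<chi> i. w $ i * f i x"] by (simp add: scalar_mult_eq_scaleR)
  ultimately show ?thesis
    unfolding Lag_def by (intro grad_eqI) (simp add: mult_ac)
qed

lemma grad_psi_PGD: "grad psi_PGD x = x"
proof (rule grad_eqI)
  have "((\<lambda>x. x \<bullet> x / 2) has_derivative (\<lambda>h. h \<bullet> x)) (at x)"
    by (auto intro!: derivative_eq_intros simp: inner_commute)
  then show "GDERIV psi_PGD x :> x"
    by (simp add: gderiv_def psi_PGD_def[abs_def] power2_norm_eq_inner)
qed

lemma grad_psi_EG:
  assumes "\<And>i. 0 < y $ i"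
  shows "grad psi_EG y = (\<chi> i. ln (y $ i) + 1)"
proof -
  have "GDERIV (\<lambda>y::real^'a. \<Sum>i\<in>UNIV. (\<lambda>s. s * ln s) (y $ i)) y :> (\<Sum>i\<in>UNIV. (ln (y $ i) + 1) *\<^sub>R axis i 1)"
  proof (intro GDERIV_sum GDERIV_DERIV_compose[where g = "\<lambda>s. s * ln s"] GDERIV_component)
    fix i
    show "((\<lambda>s. s * ln s) has_real_derivative ln (y $ i) + 1) (at (y $ i))"
      using assms[of i] by (auto intro!: derivative_eq_intros)
  qed
  moreover have "(\<Sum>i\<in>UNIV. (ln (y $ i) + 1) *\<^sub>R axis i 1) = (\<chi> i. ln (y $ i) + 1)"
    using basis_expansion[of "\<chi> i. ln (y $ i) + 1"] by (simp add: scalar_mult_eq_scaleR)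
  ultimately show ?thesis
    unfolding psi_EG_def[abs_def] by (intro grad_eqI) simp
qed

section \<open>The probability simplex and Pinsker's inequality\<close>

lemma sum_prob_simplex: "p \<in> prob_simplex \<Longrightarrow> (\<Sum>i\<in>UNIV. p $ i) = 1"
  and prob_simplex_nonneg: "p \<in> prob_simplex \<Longrightarrow> 0 \<le> p $ i"
  by (auto simp: prob_simplex_def)

lemma prob_simplex_le_one:
  fixes p :: "real^'m::finite"
  assumes "p \<in> prob_simplex"
  shows "p $ i \<le> 1"
  using member_le_sum[of i UNIV "\<lambda>i. p $ i"] assms by (auto simp: prob_simplex_def)

lemma convex_prob_simplex: "convex prob_simplex"
  unfolding convex_def prob_simplex_def
  by (auto simp: sum.distrib simp flip: sum_distrib_left)

lemma psi_EG_nonpos: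
  fixes p :: "real^'m::finite"
  assumes p: "p \<in> prob_simplex"
  shows "psi_EG p \<le> 0"
  unfolding psi_EG_def
proof (rule sum_nonpos)
  fix i
  show "p $ i * ln (p $ i) \<le> 0"
    using prob_simplex_nonneg[OF p, of i] prob_simplex_le_one[OF p, of i]
    by (cases "p $ i = 0") (auto intro!: mult_nonneg_nonpos)
qed

text \<open>The difference h of the two sides vanishes at 1, and its derivative (t - 1)^3 / (t^2 (t
  + 2)^2) has the sign of t - 1, so 1 is a global minimum. The rational term is chosen so that the
  substitution t = x / z produces the denominator x + 2z, on which the proof of Pinsker's inequality
  rests.\<close>

lemma ln_lower_bound_rational:
  fixes t :: real
  assumes "0 < t"
  shows "1 - 1 / t + 3 * (t - 1)\<^sup>2 / (2 * t * (t + 2)) \<le> ln t"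
proof -
  define h where "h t = ln t - 1 + 1 / t - 3 * (t - 1)\<^sup>2 / (2 * t * (t + 2))" for t :: real
  have D: "(h has_real_derivative (s - 1) ^ 3 / (s\<^sup>2 * (s + 2)\<^sup>2)) (at s)" if "0 < s" for s
  proof -
    have nz: "s \<noteq> 0" "s + 2 \<noteq> 0" "2 * s * (s + 2) \<noteq> 0" using that by auto
    have "(h has_real_derivative 1 / s - 1 / s\<^sup>2
        - ((6 * (s - 1)) * (2 * s * (s + 2)) - 3 * (s - 1)\<^sup>2 * (4 * s + 4)) / (2 * s * (s + 2))\<^sup>2) (at s)"
    proof -
      have "((\<lambda>s. ln s - 1 + 1 / s) has_real_derivative 1 / s - 1 / s\<^sup>2) (at s)"
        using that by (auto intro!: derivative_eq_intros simp: power2_eq_square)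
      moreover have "((\<lambda>s. 3 * (s - 1)\<^sup>2) has_real_derivative 6 * (s - 1)) (at s)"
        by (auto intro!: derivative_eq_intros)
      moreover have "((\<lambda>s. 2 * s * (s + 2)) has_real_derivative 4 * s + 4) (at s)"
        by (auto intro!: derivative_eq_intros)
      ultimately show ?thesis
        unfolding h_def[abs_def] power2_eq_square[of "2 * s * (s + 2)"] using nz
        by (intro DERIV_diff DERIV_divide) auto
    qed
    moreover have "1 / s - 1 / s\<^sup>2
        - ((6 * (s - 1)) * (2 * s * (s + 2)) - 3 * (s - 1)\<^sup>2 * (4 * s + 4)) / (2 * s * (s + 2))\<^sup>2
        = (s - 1) ^ 3 / (s\<^sup>2 * (s + 2)\<^sup>2)"
      using nz by (simp add: divide_simps) (simp add: algebra_simps power2_eq_square power3_eq_cube)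
    ultimately show ?thesis by simp
  qed
  have "h 1 \<le> h t"
  proof (cases "1 \<le> t")
    case True
    show ?thesis
    proof (rule DERIV_nonneg_imp_nondecreasing[OF True])
      fix s :: real assume "1 \<le> s"
      then show "\<exists>y. (h has_real_derivative y) (at s) \<and> 0 \<le> y"
        by (intro exI[of _ "(s - 1) ^ 3 / (s\<^sup>2 * (s + 2)\<^sup>2)"] conjI D) auto
    qed
  next
    case False
    show ?thesis
    proof (rule DERIV_nonpos_imp_nonincreasing[of t 1 h])
      fix s :: real assume "t \<le> s" "s \<le> 1"
      then show "\<exists>y. (h has_real_derivative y) (at s) \<and> y \<le> 0"
        using assms
        by (intro exI[of _ "(s - 1) ^ 3 / (s\<^sup>2 * (s + 2)\<^sup>2)"] conjI D)
           (auto intro!: divide_nonpos_nonneg simp: power3_eq_cube mult_nonneg_nonpos mult_nonpos_nonpos)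
    qed (use False in simp)
  qed
  then show ?thesis by (simp add: h_def)
qed

text \<open>Multiplying the logarithmic bound at t = x / z by x gives the claim for x > 0; for x = 0
  it reads 3z/4 \<le> z.\<close>

lemma pinsker_pointwise:
  fixes x z :: real
  assumes "0 \<le> x" "0 < z"
  shows "3 * (x - z)\<^sup>2 / (2 * (x + 2 * z)) \<le> x * ln (x / z) - x + z"
proof (cases "x = 0")
  case True
  then show ?thesis using assms by (simp add: power2_eq_square)
next
  case False
  with assms have x: "0 < x" by simp
  have "x * (1 - 1 / (x / z) + 3 * (x / z - 1)\<^sup>2 / (2 * (x / z) * (x / z + 2))) \<le> x * ln (x / z)"
    using x assms by (intro mult_left_mono ln_lower_bound_rational) auto
  moreover have "x * (1 - 1 / (x / z) + 3 * (x / z - 1)\<^sup>2 / (2 * (x / z) * (x / z + 2)))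
      = x - z + 3 * (x - z)\<^sup>2 / (2 * (x + 2 * z))"
    using x assms
    by (simp add: divide_simps) (simp add: algebra_simps power2_eq_square)
  ultimately show ?thesis by simp
qed

text \<open>At coordinates with \<open>q $ i = 0\<close> the summand is \<open>0 * ln (0 / 0) = 0\<close>.\<close>

lemma pinsker:
  fixes p q :: "real^'m::finite"
  assumes p: "p \<in> prob_simplex" and q: "q \<in> prob_simplex"
    and ac: "\<And>i. q $ i = 0 \<Longrightarrow> p $ i = 0"
  shows "(norm_L1 (p - q))\<^sup>2 / 2 \<le> (\<Sum>i\<in>UNIV. p $ i * ln (p $ i / q $ i))"
proof -
  note nn = prob_simplex_nonneg[OF p] prob_simplex_nonneg[OF q]
  define S where "S = (\<Sum>i\<in>UNIV. (p $ i - q $ i)\<^sup>2 / (p $ i + 2 * q $ i))"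
  have nz: "p $ i = q $ i" if "p $ i + 2 * q $ i = 0" for i
    using nn[of i] that by linarith
  \<comment> \<open>Cauchy-Schwarz with the weights p + 2q. Their total over the simplex is 1 + 2 =
    3, so half the squared distance is at most 3/2 times \<open>S\<close>, exactly the factor in the
    pointwise inequality.\<close>
  have "norm_L1 (p - q) = (\<Sum>i\<in>UNIV. (\<bar>p $ i - q $ i\<bar> / sqrt (p $ i + 2 * q $ i)) * sqrt (p $ i + 2 * q $ i))"
    unfolding norm_L1_def by (intro sum.cong) (auto dest: nz)
  also have "(\<dots>)\<^sup>2 \<le> (\<Sum>i\<in>UNIV. (\<bar>p $ i - q $ i\<bar> / sqrt (p $ i + 2 * q $ i))\<^sup>2) * (\<Sum>i\<in>UNIV. (sqrt (p $ i + 2 * q $ i))\<^sup>2)"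
    by (rule Cauchy_Schwarz_ineq_sum)
  also have "(\<Sum>i\<in>UNIV. (\<bar>p $ i - q $ i\<bar> / sqrt (p $ i + 2 * q $ i))\<^sup>2) = S"
    unfolding S_def using nn by (intro sum.cong) (auto simp: power_divide)
  also have "(\<Sum>i\<in>UNIV. (sqrt (p $ i + 2 * q $ i))\<^sup>2) = 3"
    using nn by (simp add: sum.distrib sum_prob_simplex[OF p] sum_prob_simplex[OF q] flip: sum_distrib_left)
  finally have "(norm_L1 (p - q))\<^sup>2 / 2 \<le> 3 / 2 * S" by simp
  also have "\<dots> = (\<Sum>i\<in>UNIV. 3 * (p $ i - q $ i)\<^sup>2 / (2 * (p $ i + 2 * q $ i)))"
    unfolding S_def sum_distrib_left by (intro sum.cong) (auto simp: field_simps)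
  also have "\<dots> \<le> (\<Sum>i\<in>UNIV. p $ i * ln (p $ i / q $ i) - p $ i + q $ i)"
  proof (rule sum_mono)
    fix i
    show "3 * (p $ i - q $ i)\<^sup>2 / (2 * (p $ i + 2 * q $ i)) \<le> p $ i * ln (p $ i / q $ i) - p $ i + q $ i"
      using ac[of i] nn[of i] pinsker_pointwise[of "p $ i" "q $ i"] by (cases "q $ i = 0") auto
  qed
  also have "\<dots> = (\<Sum>i\<in>UNIV. p $ i * ln (p $ i / q $ i))"
    by (simp add: sum.distrib sum_subtractf sum_prob_simplex[OF p] sum_prob_simplex[OF q])
  finally show ?thesis .
qed

lemma norm_L1_minus_commute: "norm_L1 (x - y) = norm_L1 (y - x)"
  by (simp add: norm_L1_def abs_minus_commute)

lemma norm_L1_scaleR: "norm_L1 (c *\<^sub>R x) = \<bar>c\<bar> * norm_L1 x"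
  by (simp add: norm_L1_def abs_mult sum_distrib_left)

lemma norm_L1_nonneg: "0 \<le> norm_L1 x"
  by (simp add: norm_L1_def sum_nonneg)

section \<open>Strong convexity of the two regularisers\<close>

lemma strongly_convex_psi_PGD: "strongly_convex_on UNIV norm 1 psi_PGD"
  unfolding strongly_convex_on_def psi_PGD_def power2_norm_eq_inner
  by (auto simp: algebra_simps inner_commute) (simp add: field_simps)

text \<open>For 0 < a < 1 the Jensen gap of the negative entropy at the mixture z = a x + (1 - a) y
  is exactly a KL(x, z) + (1 - a) KL(y, z), and Pinsker's inequality bounds both terms. Since x - z
  = (1 - a)(x - y) and y - z = a (y - x), the coefficients add up to a (1 - a)^2 / 2 + (1 - a) a^2 /
  2 = a (1 - a) / 2. A zero coordinate of z forces zeros of x and y, so the argument reaches the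
  boundary of the simplex, where the entropy has no gradient.\<close>

lemma strongly_convex_psi_EG:
  "strongly_convex_on (prob_simplex :: (real^'m::finite) set) norm_L1 1 psi_EG"
  unfolding strongly_convex_on_def
proof (intro conjI ballI convex_prob_simplex)
  fix x y :: "real^'m" and a :: real
  assume x: "x \<in> prob_simplex" and y: "y \<in> prob_simplex" and a: "a \<in> {0..1}"
  let ?z = "a *\<^sub>R x + (1 - a) *\<^sub>R y"
  show "psi_EG ?z \<le> a * psi_EG x + (1 - a) * psi_EG y - 1 / 2 * a * (1 - a) * (norm_L1 (x - y))\<^sup>2"
  proof (cases "a = 0 \<or> a = 1")
    case False
    then have a: "0 < a" "a < 1" using a by auto
    have z: "?z \<in> prob_simplex"
      using convexD[OF convex_prob_simplex x y, of a "1 - a"] a by simp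
    note nn = prob_simplex_nonneg[OF x] prob_simplex_nonneg[OF y]
    have ac: "x $ i = 0 \<and> y $ i = 0" if "?z $ i = 0" for i
    proof -
      have "a * x $ i + (1 - a) * y $ i = 0" using that by simp
      then show ?thesis using a nn[of i] by (simp add: add_nonneg_eq_0_iff)
    qed
    let ?K = "\<lambda>p. \<Sum>i\<in>UNIV. p $ i * ln (p $ i / ?z $ i)"
    have "a * ?K x + (1 - a) * ?K y = a * psi_EG x + (1 - a) * psi_EG y - psi_EG ?z"
    proof -
      have "a * (x $ i * ln (x $ i / ?z $ i)) + (1 - a) * (y $ i * ln (y $ i / ?z $ i))
          = a * (x $ i * ln (x $ i)) + (1 - a) * (y $ i * ln (y $ i)) - ?z $ i * ln (?z $ i)" for i
      proof (cases "?z $ i = 0")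
        case True
        then show ?thesis using ac[OF True] by simp
      next
        case False
        define c where "c = ?z $ i"
        have c: "0 < c" "c = a * x $ i + (1 - a) * y $ i"
          using False prob_simplex_nonneg[OF z, of i] by (auto simp: c_def)
        have *: "p * ln (p / c) = p * ln p - p * ln c" if "0 \<le> p" for p
          using that c(1) by (cases "p = 0") (simp_all add: ln_div algebra_simps)
        have "c * ln c = a * (x $ i * ln c) + (1 - a) * (y $ i * ln c)"
          by (subst c(2)) (simp add: algebra_simps)
        then show ?thesis unfolding c_def[symmetric] *[OF nn(1)] *[OF nn(2)]
          by (simp add: algebra_simps)
      qed
      then show ?thesis
        unfolding psi_EG_def sum_distrib_left sum.distrib[symmetric] sum_subtractf[symmetric]
        by (intro sum.cong) auto
    qed
    moreover have "(norm_L1 (x - ?z))\<^sup>2 / 2 \<le> ?K x" "(norm_L1 (y - ?z))\<^sup>2 / 2 \<le> ?K y"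
      using ac by (intro pinsker x y z; blast)+
    then have "a * ((norm_L1 (x - ?z))\<^sup>2 / 2) + (1 - a) * ((norm_L1 (y - ?z))\<^sup>2 / 2) \<le> a * ?K x + (1 - a) * ?K y"
      using a by (intro add_mono mult_left_mono) auto
    moreover have "norm_L1 (x - ?z) = (1 - a) * norm_L1 (x - y)"
    proof -
      have "x - ?z = (1 - a) *\<^sub>R (x - y)" by (simp add: algebra_simps)
      then show ?thesis using a by (simp only: norm_L1_scaleR abs_of_pos)
    qed
    moreover have "norm_L1 (y - ?z) = a * norm_L1 (x - y)"
    proof -
      have "y - ?z = a *\<^sub>R (y - x)" by (simp add: algebra_simps)
      then show ?thesis using a by (simp only: norm_L1_scaleR norm_L1_minus_commute[of y x] abs_of_pos)
    qed
    ultimately have "a * (((1 - a) * norm_L1 (x - y))\<^sup>2 / 2) + (1 - a) * ((a * norm_L1 (x - y))\<^sup>2 / 2)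
        \<le> a * psi_EG x + (1 - a) * psi_EG y - psi_EG ?z"
      by simp
    moreover have "a * (((1 - a) * N)\<^sup>2 / 2) + (1 - a) * ((a * N)\<^sup>2 / 2) = 1 / 2 * a * (1 - a) * N\<^sup>2" for N :: real
      by (simp add: power2_eq_square field_simps)
    ultimately show ?thesis by (simp only: le_diff_eq add.commute)
  qed auto
qed simp

section \<open>Dual pairing and norm comparisons\<close>

lemma inner_le_infnorm_norm_L1:
  fixes x y :: "real^'n"
  shows "\<bar>x \<bullet> y\<bar> \<le> infnorm x * norm_L1 y"
proof -
  have "\<bar>x \<bullet> y\<bar> \<le> (\<Sum>i\<in>UNIV. \<bar>x $ i\<bar> * \<bar>y $ i\<bar>)"
    unfolding inner_vec_def by (rule order.trans[OF sum_abs]) (simp add: abs_mult)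
  also have "\<dots> \<le> (\<Sum>i\<in>UNIV. infnorm x * \<bar>y $ i\<bar>)"
    by (intro sum_mono mult_right_mono component_le_infnorm_cart) auto
  finally show ?thesis by (simp add: norm_L1_def sum_distrib_left)
qed

lemma norm_L1_prob_simplex_diff:
  fixes p q :: "real^'m::finite"
  assumes "p \<in> prob_simplex" "q \<in> prob_simplex"
  shows "norm_L1 (p - q) \<le> 2"
proof -
  have "norm_L1 (p - q) \<le> (\<Sum>i\<in>UNIV. p $ i + q $ i)"
    unfolding norm_L1_def using prob_simplex_nonneg[OF assms(1)] prob_simplex_nonneg[OF assms(2)]
    by (intro sum_mono) (auto simp: abs_le_iff add_increasing add_increasing2)
  then show ?thesis using assms by (simp add: sum.distrib sum_prob_simplex)
qed

lemma infnorm_le_cart: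
  fixes x :: "real^'n"
  assumes "\<And>i. \<bar>x $ i\<bar> \<le> c"
  shows "infnorm x \<le> c"
  unfolding infnorm_cart using assms by (auto intro!: cSup_least)

text \<open>This comparison puts the dimension into C_\<theta> and D_\<theta>, the hypotheses being
  in the supremum norm and PGD being Euclidean.\<close>

lemma norm_sq_le_infnorm_bound:
  fixes x :: "real^'n"
  assumes "infnorm x \<le> c"
  shows "(norm x)\<^sup>2 \<le> real CARD('n) * c\<^sup>2"
proof -
  have "norm x \<le> sqrt (real CARD('n)) * c"
    using norm_le_infnorm[of x] assms mult_left_mono[of "infnorm x" c "sqrt (real CARD('n))"]
    by (simp add: order.trans)
  then have "(norm x)\<^sup>2 \<le> (sqrt (real CARD('n)) * c)\<^sup>2" by (rule power_mono) simp
  then show ?thesis by (simp add: power_mult_distrib)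
qed

lemma norm_L1_le_infnorm:
  fixes x :: "real^'n"
  assumes "infnorm x \<le> c"
  shows "norm_L1 x \<le> real CARD('n) * c"
  unfolding norm_L1_def
  using sum_bounded_above[of UNIV "\<lambda>i. \<bar>x $ i\<bar>" c] component_le_infnorm_cart[of x] assms
  by (metis order.trans of_nat_eq_iff)

lemma infnorm_diff_le:
  fixes a b :: "'a::euclidean_space"
  assumes "infnorm a \<le> c" "infnorm b \<le> c"
  shows "infnorm (a - b) \<le> 2 * c"
  using infnorm_triangle[of a "- b"] assms by (simp add: infnorm_neg)

section \<open>Regret bounds and conversions\<close>

lemma PGD_step_in:
  assumes "closed S" "S \<noteq> {}"
  shows "PGD_step S \<eta> x g \<in> S"
  unfolding PGD_step_def using assms by (rule closest_point_in_set)

text \<open>Projection is nonexpansive and fixes y, so the squared distance to y after the step is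
  at most the one before projection; expanding that square leaves the inner product and the
  second-order term.\<close>

lemma PGD_step_progress:
  assumes S: "convex S" "closed S" "y \<in> S"
  shows "2 * \<eta> * (g \<bullet> (x - y)) \<le> (norm (x - y))\<^sup>2 - (norm (PGD_step S \<eta> x g - y))\<^sup>2 + \<eta>\<^sup>2 * (norm g)\<^sup>2"
proof -
  have "norm (PGD_step S \<eta> x g - y) \<le> norm (x - \<eta> *\<^sub>R g - y)"
    using closest_point_lipschitz[of S "x - \<eta> *\<^sub>R g" y] S closest_point_self[OF S(3)]
    by (force simp: PGD_step_def dist_norm)
  then have "(norm (PGD_step S \<eta> x g - y))\<^sup>2 \<le> (norm (x - \<eta> *\<^sub>R g - y))\<^sup>2"
    by (rule power_mono) simp
  also have "\<dots> = (norm (x - y))\<^sup>2 - 2 * \<eta> * (g \<bullet> (x - y)) + \<eta>\<^sup>2 * (norm g)\<^sup>2"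
    unfolding power2_norm_eq_inner
    by (simp add: algebra_simps inner_commute power2_eq_square)
  finally show ?thesis by simp
qed

text \<open>The squared distances to y telescope and the last one is dropped. The factor 2\<eta> is
  kept on the left so that the bounds for an iterate and for its ghost can be added before
  dividing.\<close>

lemma PGD_regret:
  fixes x g :: "nat \<Rightarrow> real^'d"
  assumes S: "convex S" "closed S" "y \<in> S"
    and step: "\<And>t. t \<in> {1..T} \<Longrightarrow> x (t + 1) = PGD_step S \<eta> (x t) (g t)"
  shows "2 * \<eta> * (\<Sum>t=1..T. g t \<bullet> (x t - y)) \<le> (norm (x 1 - y))\<^sup>2 + \<eta>\<^sup>2 * (\<Sum>t=1..T. (norm (g t))\<^sup>2)"
proof -
  have "2 * \<eta> * (\<Sum>t=1..n. g t \<bullet> (x t - y))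
      \<le> (norm (x 1 - y))\<^sup>2 - (norm (x (n + 1) - y))\<^sup>2 + \<eta>\<^sup>2 * (\<Sum>t=1..n. (norm (g t))\<^sup>2)"
    if "n \<le> T" for n
    using that
  proof (induction n)
    case (Suc n)
    have "x (Suc n + 1) = PGD_step S \<eta> (x (n + 1)) (g (n + 1))"
      using step[of "n + 1"] Suc.prems by simp
    then have "2 * \<eta> * (g (n + 1) \<bullet> (x (n + 1) - y))
        \<le> (norm (x (n + 1) - y))\<^sup>2 - (norm (x (Suc n + 1) - y))\<^sup>2 + \<eta>\<^sup>2 * (norm (g (n + 1)))\<^sup>2"
      using PGD_step_progress[OF S, of \<eta> "g (n + 1)" "x (n + 1)"] by simp
    then show ?case using Suc.IH Suc.prems by (simp add: algebra_simps)
  qed simp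
  from this[of T] show ?thesis
    using zero_le_power2[of "norm (x (T + 1) - y)"] by linarith
qed

section \<open>Exponentiated gradient\<close>

definition pos_simplex :: "(real^'m) set" where
  "pos_simplex = {p \<in> prob_simplex. \<forall>i. 0 < p $ i}"

lemma pos_simplexD:
  assumes "p \<in> pos_simplex"
  shows "p \<in> prob_simplex" "0 < p $ i"
  using assms by (auto simp: pos_simplex_def)

lemma uniform_pos_simplex: "(\<chi> i. 1 / real CARD('m)) \<in> (pos_simplex :: (real^'m::finite) set)"
  by (simp add: pos_simplex_def prob_simplex_def)

lemma EG_normaliser_pos:
  fixes l :: "real^'m::finite"
  assumes "l \<in> pos_simplex"
  shows "0 < (\<Sum>j\<in>UNIV. l $ j * exp (\<eta> * g $ j))"
  using pos_simplexD(2)[OF assms] by (intro sum_pos) auto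

lemma EG_step_pos_simplex:
  fixes l :: "real^'m::finite"
  assumes "l \<in> pos_simplex"
  shows "EG_step \<eta> l g \<in> pos_simplex"
  using EG_normaliser_pos[OF assms, of \<eta> g] pos_simplexD(2)[OF assms]
  by (auto simp: pos_simplex_def prob_simplex_def EG_step_def less_imp_le simp flip: sum_divide_distrib)

text \<open>By Pinsker's inequality the relative entropy between consecutive iterates pays for the
  second-order term.\<close>

lemma EG_ln_normaliser_le:
  fixes l g :: "real^'m::finite"
  assumes l: "l \<in> pos_simplex" and C: "infnorm g \<le> C" and \<eta>: "0 \<le> \<eta>"
  shows "ln (\<Sum>j\<in>UNIV. l $ j * exp (\<eta> * g $ j)) \<le> \<eta> * (g \<bullet> l) + \<eta>\<^sup>2 * C\<^sup>2 / 2"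
proof -
  define W where "W = (\<Sum>j\<in>UNIV. l $ j * exp (\<eta> * g $ j))"
  define p where "p = EG_step \<eta> l g"
  note W = EG_normaliser_pos[OF l, of \<eta> g, folded W_def]
  have p: "p \<in> pos_simplex" unfolding p_def by (rule EG_step_pos_simplex[OF l])
  have ratio: "p $ i / l $ i = exp (\<eta> * g $ i) / W" for i
    using pos_simplexD(2)[OF l, of i] by (simp add: p_def EG_step_def W_def)
  have "(norm_L1 (p - l))\<^sup>2 / 2 \<le> (\<Sum>i\<in>UNIV. p $ i * ln (p $ i / l $ i))"
    using pos_simplexD[OF p] pos_simplexD[OF l] by (intro pinsker) (auto simp: less_le)
  also have "\<dots> = (\<Sum>i\<in>UNIV. \<eta> * (g $ i * p $ i) - p $ i * ln W)"
    unfolding ratio using W by (intro sum.cong) (auto simp: ln_div algebra_simps)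
  also have "\<dots> = \<eta> * (g \<bullet> p) - ln W"
    using sum_prob_simplex[OF pos_simplexD(1)[OF p]]
    by (simp add: sum_subtractf inner_vec_def flip: sum_distrib_left sum_distrib_right)
  finally have "ln W \<le> \<eta> * (g \<bullet> l) + \<eta> * (g \<bullet> (p - l)) - (norm_L1 (p - l))\<^sup>2 / 2"
    by (simp add: algebra_simps)
  moreover have "g \<bullet> (p - l) \<le> C * norm_L1 (p - l)"
    using inner_le_infnorm_norm_L1[of g "p - l"] mult_right_mono[OF C norm_L1_nonneg[of "p - l"]]
    by linarith
  then have "\<eta> * (g \<bullet> (p - l)) \<le> \<eta> * C * norm_L1 (p - l)"
    using \<eta> by (simp add: mult_left_mono mult.assoc)
  \<comment> \<open>Completing the square: over all values N of the distance, \<eta>CN - N^2/2 is at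
    most (\<eta>C)^2/2.\<close>
  moreover have "0 \<le> (\<eta> * C - norm_L1 (p - l))\<^sup>2" by simp
  ultimately show ?thesis unfolding W_def[symmetric] by (simp add: power2_eq_square algebra_simps)
qed

text \<open>The potential is the logarithm of the i-th coordinate: a step adds \<eta> times the i-th
  gradient entry and subtracts the log-normaliser. It starts at -ln m and never exceeds 0, since a
  coordinate of a simplex point is at most 1. Vertices are the only comparators required, because
  \<open>TCH\<close> is attained at a single objective.\<close>

lemma EG_regret:
  fixes l g :: "nat \<Rightarrow> real^'m::finite"
  assumes init: "l 1 = (\<chi> i. 1 / real CARD('m))"
    and step: "\<And>t. t \<in> {1..T} \<Longrightarrow> l (t + 1) = EG_step \<eta> (l t) (g t)"
    and C: "\<And>t. t \<in> {1..T} \<Longrightarrow> infnorm (g t) \<le> C" and \<eta>: "0 \<le> \<eta>"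
  shows "\<eta> * (\<Sum>t=1..T. g t $ i - g t \<bullet> l t) \<le> ln (real CARD('m)) + real T * (\<eta>\<^sup>2 * C\<^sup>2 / 2)"
proof -
  have "l (n + 1) \<in> pos_simplex \<and>
      \<eta> * (\<Sum>t=1..n. g t $ i - g t \<bullet> l t) - real n * (\<eta>\<^sup>2 * C\<^sup>2 / 2) - ln (real CARD('m)) \<le> ln (l (n + 1) $ i)"
    if "n \<le> T" for n
    using that
  proof (induction n)
    case 0
    then show ?case using init uniform_pos_simplex by (simp add: ln_div)
  next
    case (Suc n)
    let ?l = "l (n + 1)" and ?g = "g (n + 1)"
    let ?W = "\<Sum>j\<in>UNIV. ?l $ j * exp (\<eta> * ?g $ j)"
    have l: "?l \<in> pos_simplex" using Suc by simp
    have next_l: "l (Suc n + 1) = EG_step \<eta> ?l ?g"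
      using step[of "n + 1"] Suc.prems by simp
    have "ln (l (Suc n + 1) $ i) = ln (?l $ i) + \<eta> * ?g $ i - ln ?W"
      unfolding next_l EG_step_def
      using EG_normaliser_pos[OF l, of \<eta> ?g] pos_simplexD(2)[OF l, of i]
      by (simp add: ln_div ln_mult)
    moreover have "ln ?W \<le> \<eta> * (?g \<bullet> ?l) + \<eta>\<^sup>2 * C\<^sup>2 / 2"
      using C[of "n + 1"] Suc.prems by (intro EG_ln_normaliser_le l \<eta>) auto
    moreover have "\<eta> * (\<Sum>t=1..n. g t $ i - g t \<bullet> l t) - real n * (\<eta>\<^sup>2 * C\<^sup>2 / 2) - ln (real CARD('m)) \<le> ln (?l $ i)"
      using Suc by simp
    moreover have "\<eta> * (\<Sum>t=1..Suc n. g t $ i - g t \<bullet> l t)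
        = \<eta> * (\<Sum>t=1..n. g t $ i - g t \<bullet> l t) + (\<eta> * ?g $ i - \<eta> * (?g \<bullet> ?l))"
      by (simp add: algebra_simps)
    moreover have "real (Suc n) * (\<eta>\<^sup>2 * C\<^sup>2 / 2) = real n * (\<eta>\<^sup>2 * C\<^sup>2 / 2) + \<eta>\<^sup>2 * C\<^sup>2 / 2"
      by (simp add: algebra_simps)
    ultimately have "\<eta> * (\<Sum>t=1..Suc n. g t $ i - g t \<bullet> l t) - real (Suc n) * (\<eta>\<^sup>2 * C\<^sup>2 / 2) - ln (real CARD('m))
        \<le> ln (l (Suc n + 1) $ i)"
      by linarith
    then show ?case using EG_step_pos_simplex[OF l, of \<eta> ?g] next_l by simp
  qed
  from this[of T] have "l (T + 1) \<in> pos_simplex"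
    "\<eta> * (\<Sum>t=1..T. g t $ i - g t \<bullet> l t) - real T * (\<eta>\<^sup>2 * C\<^sup>2 / 2) - ln (real CARD('m)) \<le> ln (l (T + 1) $ i)"
    by auto
  moreover from this(1) have "ln (l (T + 1) $ i) \<le> 0"
    using pos_simplexD[of "l (T + 1)"] prob_simplex_le_one[of "l (T + 1)" i] by simp
  ultimately show ?thesis by simp
qed

lemma EG_path_pos_simplex:
  fixes l g :: "nat \<Rightarrow> real^'m::finite"
  assumes "l 1 = (\<chi> i. 1 / real CARD('m))"
    and "\<And>t. t \<in> {1..T} \<Longrightarrow> l (t + 1) = EG_step \<eta> (l t) (g t)"
    and "1 \<le> n" "n \<le> T + 1"
  shows "l n \<in> pos_simplex"
  using assms(3,4)
proof (induction n rule: dec_induct)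
  case base
  then show ?case using assms(1) uniform_pos_simplex by simp
next
  case (step n)
  then show ?case using assms(2)[of n] EG_step_pos_simplex by simp
qed

lemma PGD_path_in:
  fixes x g :: "nat \<Rightarrow> real^'d"
  assumes "closed S" "x 1 \<in> S"
    and "\<And>t. t \<in> {1..T} \<Longrightarrow> x (t + 1) = PGD_step S \<eta> (x t) (g t)"
    and "1 \<le> n" "n \<le> T + 1"
  shows "x n \<in> S"
  using assms(4,5)
proof (induction n rule: dec_induct)
  case base
  then show ?case using assms(2) by simp
next
  case (step n)
  then show ?case using assms(3)[of n] PGD_step_in[OF assms(1)] by force
qed

text \<open>With a single objective ln m = 0, so the prescribed EG step size is 0 and a regret bound
  multiplied by it carries no information. This case is settled directly: all iterates coincide with
  the only vertex and the regret is 0.\<close>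

lemma prob_simplex_trivial:
  fixes p q :: "real^'m::finite"
  assumes "CARD('m) = 1" "p \<in> prob_simplex"
  shows "p $ i = 1"
proof -
  have "(UNIV :: 'm set) = {i}" using assms(1) by (metis UNIV_I card_1_singletonE singletonD)
  then have "(\<Sum>j\<in>UNIV. p $ j) = (\<Sum>j\<in>{i}. p $ j)" by (rule arg_cong)
  then show ?thesis using sum_prob_simplex[OF assms(2)] by simp
qed

text \<open>The deterministic core. Each term splits as G (x - y) = g (x - y) + (G - g)(u - y) + (G
  - g)(x - u): the regret of the iterate x on the estimates, the regret of the ghost u on the noise,
  and a remainder without y. The maximising player splits in the same way, with reversed signs and
  the ghost v.\<close>

lemma saddle_regret:
  fixes x u g G :: "nat \<Rightarrow> real^'d" and l v gl Gl :: "nat \<Rightarrow> real^'m::finite"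
  assumes T: "1 \<le> T" and S: "convex S" "closed S" and x1: "x 1 \<in> S" "u 1 = x 1" and y: "y \<in> S"
    and R: "\<And>z. z \<in> S \<Longrightarrow> infnorm z \<le> R" and pos: "0 < U" "0 < L" "0 < R"
    and \<eta>\<theta>: "\<eta>\<theta> = sqrt (8 * R\<^sup>2 / (5 * real T * L\<^sup>2))"
    and \<eta>l: "\<eta>l = sqrt (4 * ln (real CARD('m)) / (5 * real T * U\<^sup>2))"
    and l1: "l 1 = (\<chi> i. 1 / real CARD('m))" "v 1 = (\<chi> i. 1 / real CARD('m))"
    and x_step: "\<And>t. t \<in> {1..T} \<Longrightarrow> x (t + 1) = PGD_step S \<eta>\<theta> (x t) (g t)"
    and u_step: "\<And>t. t \<in> {1..T} \<Longrightarrow> u (t + 1) = PGD_step S \<eta>\<theta> (u t) (G t - g t)"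
    and l_step: "\<And>t. t \<in> {1..T} \<Longrightarrow> l (t + 1) = EG_step \<eta>l (l t) (gl t)"
    and v_step: "\<And>t. t \<in> {1..T} \<Longrightarrow> v (t + 1) = EG_step \<eta>l (v t) (Gl t - gl t)"
    and g: "\<And>t. t \<in> {1..T} \<Longrightarrow> infnorm (g t) \<le> L" and G: "\<And>t. t \<in> {1..T} \<Longrightarrow> infnorm (G t) \<le> L"
    and gl: "\<And>t. t \<in> {1..T} \<Longrightarrow> infnorm (gl t) \<le> U" and Gl: "\<And>t. t \<in> {1..T} \<Longrightarrow> infnorm (Gl t) \<le> U"
  shows "(\<Sum>t=1..T. G t \<bullet> (x t - y) + (Gl t $ i - Gl t \<bullet> l t))
    \<le> sqrt (real T) * (2 * sqrt 10 * real CARD('d) * R * L + 2 * sqrt 5 * sqrt (ln (real CARD('m))) * U)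
      + (\<Sum>t=1..T. (G t - g t) \<bullet> (x t - u t) + (Gl t - gl t) \<bullet> (v t - l t))"
proof -
  let ?d = "real CARD('d)" and ?m = "real CARD('m)"
  have T0: "0 < real T" using T by simp
  have \<eta>\<theta>_pos: "0 < \<eta>\<theta>" using T0 pos by (simp add: \<eta>\<theta>)
  have \<eta>\<theta>_sq: "\<eta>\<theta>\<^sup>2 * (5 * real T * L\<^sup>2) = 8 * R\<^sup>2" using T0 pos by (simp add: \<eta>\<theta>)
  have m: "0 \<le> ln ?m" by (simp add: Suc_leI)
  have \<eta>l_nonneg: "0 \<le> \<eta>l" using T0 pos m by (simp add: \<eta>l)
  have \<eta>l_sq: "\<eta>l\<^sup>2 * (5 * real T * U\<^sup>2) = 4 * ln ?m" using T0 pos m by (simp add: \<eta>l)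

  have "(norm (x 1 - y))\<^sup>2 \<le> ?d * (2 * R)\<^sup>2"
    by (intro norm_sq_le_infnorm_bound infnorm_diff_le R x1 y)
  moreover have "(\<Sum>t=1..T. (norm (g t))\<^sup>2) \<le> real T * (?d * L\<^sup>2)"
    using sum_bounded_above[of "{1..T}" "\<lambda>t. (norm (g t))\<^sup>2" "?d * L\<^sup>2"] norm_sq_le_infnorm_bound[OF g] by simp
  then have "\<eta>\<theta>\<^sup>2 * (\<Sum>t=1..T. (norm (g t))\<^sup>2) \<le> \<eta>\<theta>\<^sup>2 * (real T * (?d * L\<^sup>2))" by (rule mult_left_mono) simp
  moreover have "(\<Sum>t=1..T. (norm (G t - g t))\<^sup>2) \<le> real T * (?d * (2 * L)\<^sup>2)"
    using sum_bounded_above[of "{1..T}" "\<lambda>t. (norm (G t - g t))\<^sup>2" "?d * (2 * L)\<^sup>2"]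
      norm_sq_le_infnorm_bound[OF infnorm_diff_le[OF G g]] by simp
  then have "\<eta>\<theta>\<^sup>2 * (\<Sum>t=1..T. (norm (G t - g t))\<^sup>2) \<le> \<eta>\<theta>\<^sup>2 * (real T * (?d * (2 * L)\<^sup>2))" by (rule mult_left_mono) simp
  moreover note PGD_regret[where T = T and x = x and g = g, OF S y x_step]
    PGD_regret[where T = T and x = u and g = "\<lambda>t. G t - g t", OF S y u_step, unfolded x1(2)]
  ultimately have "2 * \<eta>\<theta> * (\<Sum>t=1..T. g t \<bullet> (x t - y)) + 2 * \<eta>\<theta> * (\<Sum>t=1..T. (G t - g t) \<bullet> (u t - y))
      \<le> 2 * (?d * (2 * R)\<^sup>2) + \<eta>\<theta>\<^sup>2 * (real T * (?d * L\<^sup>2)) + \<eta>\<theta>\<^sup>2 * (real T * (?d * (2 * L)\<^sup>2))"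
    by linarith
  also have "\<dots> = ?d * (8 * R\<^sup>2 + \<eta>\<theta>\<^sup>2 * (5 * real T * L\<^sup>2))"
    by (simp add: power_mult_distrib algebra_simps)
  \<comment> \<open>By the choice of the step size both summands in the bracket equal 8R^2, so the
    total is 16 d R^2.\<close>
  also have "\<dots> = 2 * \<eta>\<theta> * (sqrt (real T) * (2 * sqrt 10 * ?d * R * L))"
  proof -
    have "\<eta>\<theta> = sqrt 8 * R / (sqrt 5 * sqrt (real T) * L)"
      using pos by (simp add: \<eta>\<theta> real_sqrt_divide real_sqrt_mult)
    then have "\<eta>\<theta> * (sqrt (real T) * (sqrt 10 * R * L)) = (sqrt 8 * sqrt 10 / sqrt 5) * R\<^sup>2"
      using T0 pos by (simp add: field_simps power2_eq_square)
    also have "sqrt 8 * sqrt 10 / sqrt 5 = (4 :: real)"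
    proof -
      have "sqrt 8 * sqrt 10 / sqrt 5 = sqrt (8 * 10 / 5 :: real)" by (simp only: real_sqrt_mult real_sqrt_divide)
      also have "\<dots> = sqrt (4 ^ 2)" by simp
      finally show ?thesis by (simp only: real_sqrt_pow2_iff real_sqrt_abs abs_numeral)
    qed
    finally show ?thesis unfolding \<eta>\<theta>_sq by (simp add: algebra_simps)
  qed
  finally have "2 * \<eta>\<theta> * ((\<Sum>t=1..T. g t \<bullet> (x t - y)) + (\<Sum>t=1..T. (G t - g t) \<bullet> (u t - y)))
      \<le> 2 * \<eta>\<theta> * (sqrt (real T) * (2 * sqrt 10 * ?d * R * L))"
    by (simp add: algebra_simps)
  then have theta: "(\<Sum>t=1..T. g t \<bullet> (x t - y)) + (\<Sum>t=1..T. (G t - g t) \<bullet> (u t - y))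
      \<le> sqrt (real T) * (2 * sqrt 10 * ?d * R * L)"
    using \<eta>\<theta>_pos by simp

  have lambda: "(\<Sum>t=1..T. gl t $ i - gl t \<bullet> l t) + (\<Sum>t=1..T. (Gl t - gl t) $ i - (Gl t - gl t) \<bullet> v t)
      \<le> sqrt (real T) * (2 * sqrt 5 * sqrt (ln ?m) * U)"
  proof (cases "CARD('m) = 1")
    case True
    then have U: "(UNIV :: 'm set) = {i}" by (metis UNIV_I card_1_singletonE singletonD)
    have "l t $ i = 1 \<and> v t $ i = 1" if "t \<in> {1..T}" for t
      using EG_path_pos_simplex[where l = l, OF l1(1) l_step, of T t] EG_path_pos_simplex[where l = v, OF l1(2) v_step, of T t]
        that prob_simplex_trivial[OF True] by (simp add: pos_simplexD(1))
    then show ?thesis by (simp add: inner_vec_def U True)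
  next
    case False
    then have "1 < CARD('m)" by (simp add: Suc_lessI)
    then have "0 < ln ?m" by simp
    then have \<eta>l_pos: "0 < \<eta>l" using T0 pos by (simp add: \<eta>l)
    have "\<eta>l * (\<Sum>t=1..T. gl t $ i - gl t \<bullet> l t) \<le> ln ?m + real T * (\<eta>l\<^sup>2 * U\<^sup>2 / 2)"
      by (intro EG_regret l1 l_step gl \<eta>l_nonneg)
    moreover have "\<eta>l * (\<Sum>t=1..T. (Gl t - gl t) $ i - (Gl t - gl t) \<bullet> v t) \<le> ln ?m + real T * (\<eta>l\<^sup>2 * (2 * U)\<^sup>2 / 2)"
      by (intro EG_regret[where g = "\<lambda>t. Gl t - gl t"] l1 v_step infnorm_diff_le gl Gl \<eta>l_nonneg)
    ultimately have "\<eta>l * ((\<Sum>t=1..T. gl t $ i - gl t \<bullet> l t) + (\<Sum>t=1..T. (Gl t - gl t) $ i - (Gl t - gl t) \<bullet> v t))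
        \<le> 2 * ln ?m + \<eta>l\<^sup>2 * (5 * real T * U\<^sup>2) / 2"
      by (simp add: power_mult_distrib algebra_simps)
    \<comment> \<open>Again the step size balances: the second summand equals 2 ln m as
      well.\<close>
    also have "\<dots> = \<eta>l * (sqrt (real T) * (2 * sqrt 5 * sqrt (ln ?m) * U))"
    proof -
      have "\<eta>l = 2 * sqrt (ln ?m) / (sqrt 5 * sqrt (real T) * U)"
        using pos by (simp add: \<eta>l real_sqrt_divide real_sqrt_mult)
      then have "\<eta>l * (sqrt (real T) * (2 * sqrt 5 * sqrt (ln ?m) * U)) = 4 * (sqrt (ln ?m) * sqrt (ln ?m))"
        using T0 pos by simp
      then show ?thesis unfolding \<eta>l_sq using m by simp
    qed
    finally show ?thesis using \<eta>l_pos by simp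
  qed

  have "G t \<bullet> (x t - y) + (Gl t $ i - Gl t \<bullet> l t)
      = (g t \<bullet> (x t - y) + (G t - g t) \<bullet> (u t - y)) + ((gl t $ i - gl t \<bullet> l t) + ((Gl t - gl t) $ i - (Gl t - gl t) \<bullet> v t))
        + ((G t - g t) \<bullet> (x t - u t) + (Gl t - gl t) \<bullet> (v t - l t))" for t
    by (simp add: inner_diff_left inner_diff_right)
  then show ?thesis using theta lambda by (simp add: sum.distrib distrib_left del: vector_minus_component)
qed

section \<open>Uniform and adaptive conversion\<close>

text \<open>All that the gap bound needs to know about either conversion.\<close>

definition averages_at_most :: "'a set \<Rightarrow> ('m \<Rightarrow> 'a \<Rightarrow> real) \<Rightarrow> nat \<Rightarrow> (nat \<Rightarrow> 'a) \<Rightarrow> 'a \<Rightarrow> bool" where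
  "averages_at_most S f T x xhat \<longleftrightarrow> xhat \<in> S \<and> (\<forall>i. real T * f i xhat \<le> (\<Sum>t=1..T. f i (x t)))"

lemma averages_at_most_weighted:
  assumes T: "1 \<le> T" and S: "convex S" and f: "\<And>i. convex_on S (f i)"
    and P: "finite P" "\<And>\<tau>. \<tau> \<in> P \<Longrightarrow> x \<tau> \<in> S" "\<And>\<tau>. \<tau> \<in> P \<Longrightarrow> 0 \<le> \<gamma> \<tau>" "sum \<gamma> P = real T"
    and le: "\<And>i. (\<Sum>\<tau>\<in>P. \<gamma> \<tau> * f i (x \<tau>)) \<le> (\<Sum>t=1..T. f i (x t))"
  shows "averages_at_most S f T x ((1 / real T) *\<^sub>R (\<Sum>\<tau>\<in>P. \<gamma> \<tau> *\<^sub>R x \<tau>))"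
proof -
  have eq: "(1 / real T) *\<^sub>R (\<Sum>\<tau>\<in>P. \<gamma> \<tau> *\<^sub>R x \<tau>) = (\<Sum>\<tau>\<in>P. (\<gamma> \<tau> / real T) *\<^sub>R x \<tau>)"
    by (simp add: scaleR_sum_right)
  have sum1: "(\<Sum>\<tau>\<in>P. \<gamma> \<tau> / real T) = 1" using P(4) T by (simp flip: sum_divide_distrib)
  have "P \<noteq> {}" using P(4) T by auto
  have "real T * f i (\<Sum>\<tau>\<in>P. (\<gamma> \<tau> / real T) *\<^sub>R x \<tau>) \<le> (\<Sum>t=1..T. f i (x t))" for i
  proof -
    have "f i (\<Sum>\<tau>\<in>P. (\<gamma> \<tau> / real T) *\<^sub>R x \<tau>) \<le> (\<Sum>\<tau>\<in>P. \<gamma> \<tau> / real T * f i (x \<tau>))"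
      using P \<open>P \<noteq> {}\<close> sum1 by (intro convex_on_sum[OF _ _ f]) auto
    also have "\<dots> = (\<Sum>\<tau>\<in>P. \<gamma> \<tau> * f i (x \<tau>)) / real T" by (simp add: sum_divide_distrib)
    also have "\<dots> \<le> (\<Sum>t=1..T. f i (x t)) / real T" by (intro divide_right_mono le) simp
    finally show ?thesis using T by (simp add: field_simps)
  qed
  moreover have "(\<Sum>\<tau>\<in>P. (\<gamma> \<tau> / real T) *\<^sub>R x \<tau>) \<in> S"
    using P sum1 by (intro convex_sum S) auto
  ultimately show ?thesis unfolding averages_at_most_def eq by blast
qed

lemma averages_at_most_time_average:
  assumes "1 \<le> T" "convex S" "\<And>i. convex_on S (f i)" "\<And>t. t \<in> {1..T} \<Longrightarrow> x t \<in> S"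
  shows "averages_at_most S f T x (time_average T x)"
  using averages_at_most_weighted[of T S f "{1..T}" x "\<lambda>_. 1"] assms by (simp add: time_average_def)

text \<open>Each round adds mass 1 without raising any weighted objective sum beyond the plain one.
  If dominators exist, the new mass is shared among them, and none has a larger objective than the
  new iterate. Otherwise the new iterate takes over the mass of the elements it dominates, and its
  objectives are no larger than theirs.\<close>

lemma ada_state_invariant:
  assumes "ada_state f x n = (P, \<gamma>)"
  shows "P \<subseteq> {1..n} \<and> (\<forall>\<tau>\<in>P. 0 \<le> \<gamma> \<tau>) \<and> sum \<gamma> P = real n
    \<and> (\<forall>i. (\<Sum>\<tau>\<in>P. \<gamma> \<tau> * f i (x \<tau>)) \<le> (\<Sum>t=1..n. f i (x t)))"
  using assms
proof (induction n arbitrary: P \<gamma>)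
  case 0
  then show ?case by simp
next
  case (Suc n)
  obtain P0 \<gamma>0 where st: "ada_state f x n = (P0, \<gamma>0)" by (cases "ada_state f x n")
  from Suc.IH[OF st] have sub: "P0 \<subseteq> {1..n}" and nn: "\<And>\<tau>. \<tau> \<in> P0 \<Longrightarrow> 0 \<le> \<gamma>0 \<tau>" and sum: "sum \<gamma>0 P0 = real n"
    and le: "\<And>i. (\<Sum>\<tau>\<in>P0. \<gamma>0 \<tau> * f i (x \<tau>)) \<le> (\<Sum>t=1..n. f i (x t))" by auto
  have fin: "finite P0" using sub finite_subset by blast
  define A where "A = {\<tau>\<in>P0. dominates f (x \<tau>) (x (Suc n))}"
  define B where "B = {\<tau>\<in>P0. dominates f (x (Suc n)) (x \<tau>)}"
  have A: "A \<subseteq> P0" "finite A" and B: "B \<subseteq> P0" "finite B"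
    using fin by (auto simp: A_def B_def)
  have next_state: "(P, \<gamma>) = (if A \<noteq> {}
      then (P0, \<lambda>\<tau>. if \<tau> \<in> A then \<gamma>0 \<tau> + 1 / real (card A) else \<gamma>0 \<tau>)
      else (insert (Suc n) (P0 - B), \<gamma>0(Suc n := 1 + sum \<gamma>0 B)))"
    unfolding Suc.prems[symmetric] A_def B_def by (simp only: ada_state.simps st Let_def prod.case)
  show ?case
  proof (cases "A = {}")
    case False
    define c where "c = 1 / real (card A)"
    have cA: "c * real (card A) = 1" "0 \<le> c" using False A by (auto simp: c_def)
    have P: "P = P0" "\<gamma> = (\<lambda>\<tau>. if \<tau> \<in> A then \<gamma>0 \<tau> + c else \<gamma>0 \<tau>)"
      using next_state False unfolding c_def by (simp_all only: if_True not_False_eq_True prod.inject)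
    have \<gamma>: "\<gamma> \<tau> = \<gamma>0 \<tau> + (if \<tau> \<in> A then c else 0)" for \<tau> by (simp add: P)
    have add: "(\<Sum>\<tau>\<in>P0. \<gamma> \<tau> * h \<tau>) = (\<Sum>\<tau>\<in>P0. \<gamma>0 \<tau> * h \<tau>) + (\<Sum>\<tau>\<in>A. c * h \<tau>)" for h
    proof -
      have "(\<Sum>\<tau>\<in>P0. \<gamma> \<tau> * h \<tau>) = (\<Sum>\<tau>\<in>P0. \<gamma>0 \<tau> * h \<tau>) + (\<Sum>\<tau>\<in>P0. if \<tau> \<in> A then c * h \<tau> else 0)"
        unfolding sum.distrib[symmetric] by (intro sum.cong) (auto simp: \<gamma> algebra_simps)
      also have "(\<Sum>\<tau>\<in>P0. if \<tau> \<in> A then c * h \<tau> else 0) = (\<Sum>\<tau>\<in>A. c * h \<tau>)"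
        using A(1) fin by (simp add: sum.If_cases Int_absorb1)
      finally show ?thesis .
    qed
    have "(\<Sum>\<tau>\<in>A. c * f i (x \<tau>)) \<le> f i (x (Suc n))" for i
    proof -
      have "(\<Sum>\<tau>\<in>A. c * f i (x \<tau>)) \<le> (\<Sum>\<tau>\<in>A. c * f i (x (Suc n)))"
        using cA by (intro sum_mono mult_left_mono) (auto simp: A_def dominates_def)
      also have "\<dots> = c * real (card A) * f i (x (Suc n))" by simp
      finally show ?thesis by (simp add: cA)
    qed
    then have "(\<Sum>\<tau>\<in>P. \<gamma> \<tau> * f i (x \<tau>)) \<le> (\<Sum>t=1..Suc n. f i (x t))" for i
      unfolding P(1) add using add_mono[OF le[of i]] by simp
    moreover have "sum \<gamma> P = real (Suc n)"
      using add[of "\<lambda>_. 1"] sum cA by (simp add: P(1) mult.commute)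
    ultimately show ?thesis using sub nn cA by (auto simp: P)
  next
    case True
    have P: "P = insert (Suc n) (P0 - B)" "\<gamma> = \<gamma>0(Suc n := 1 + sum \<gamma>0 B)"
      using next_state True by simp_all
    \<comment> \<open>Freshness of the new index: the update of the weight function overwrites no
      weight still in use.\<close>
    have new: "Suc n \<notin> P0" using sub by auto
    have add: "(\<Sum>\<tau>\<in>P. \<gamma> \<tau> * h \<tau>) = (\<Sum>\<tau>\<in>P0. \<gamma>0 \<tau> * h \<tau>) - (\<Sum>\<tau>\<in>B. \<gamma>0 \<tau> * h \<tau>) + (1 + sum \<gamma>0 B) * h (Suc n)" for h
    proof -
      have "(\<Sum>\<tau>\<in>P. \<gamma> \<tau> * h \<tau>) = (1 + sum \<gamma>0 B) * h (Suc n) + (\<Sum>\<tau>\<in>P0 - B. \<gamma> \<tau> * h \<tau>)"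
        using fin new by (simp add: P)
      also have "(\<Sum>\<tau>\<in>P0 - B. \<gamma> \<tau> * h \<tau>) = (\<Sum>\<tau>\<in>P0 - B. \<gamma>0 \<tau> * h \<tau>)"
        using new by (intro sum.cong) (auto simp: P)
      also have "\<dots> = (\<Sum>\<tau>\<in>P0. \<gamma>0 \<tau> * h \<tau>) - (\<Sum>\<tau>\<in>B. \<gamma>0 \<tau> * h \<tau>)"
        using fin B by (simp add: sum_diff)
      finally show ?thesis by simp
    qed
    have "sum \<gamma>0 B * f i (x (Suc n)) \<le> (\<Sum>\<tau>\<in>B. \<gamma>0 \<tau> * f i (x \<tau>))" for i
      unfolding sum_distrib_right using nn
      by (intro sum_mono mult_left_mono) (auto simp: B_def dominates_def)
    from add_mono[OF this le] have "(\<Sum>\<tau>\<in>P. \<gamma> \<tau> * f i (x \<tau>)) \<le> (\<Sum>t=1..Suc n. f i (x t))" for i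
      unfolding add by (simp add: algebra_simps)
    moreover have "sum \<gamma> P = real (Suc n)"
      using add[of "\<lambda>_. 1"] sum by simp
    moreover have "0 \<le> sum \<gamma>0 B" using nn B by (intro sum_nonneg) auto
    ultimately show ?thesis using sub nn by (auto simp: P)
  qed
qed

lemma averages_at_most_ada_average:
  assumes "1 \<le> T" "convex S" "\<And>i. convex_on S (f i)" "\<And>t. t \<in> {1..T} \<Longrightarrow> x t \<in> S"
  shows "averages_at_most S f T x (ada_average f T x)"
proof -
  obtain P \<gamma> where st: "ada_state f x T = (P, \<gamma>)" by (cases "ada_state f x T")
  note inv = ada_state_invariant[OF st]
  then have "finite P" using finite_subset by blast
  then have "averages_at_most S f T x ((1 / real T) *\<^sub>R (\<Sum>\<tau>\<in>P. \<gamma> \<tau> *\<^sub>R x \<tau>))"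
    using inv assms by (intro averages_at_most_weighted) auto
  then show ?thesis by (simp add: ada_average_def st)
qed

section \<open>Measurability and concentration\<close>

lemma borel_measurable_vec_iff:
  fixes f :: "'a \<Rightarrow> real^'n"
  shows "f \<in> borel_measurable M \<longleftrightarrow> (\<forall>i. (\<lambda>x. f x $ i) \<in> borel_measurable M)"
  unfolding borel_measurable_euclidean_space[of f] Basis_vec_def by (auto simp: inner_axis)

lemma borel_measurable_vec_lambda:
  fixes f :: "'a \<Rightarrow> 'n::finite \<Rightarrow> real"
  assumes "\<And>i. (\<lambda>x. f x i) \<in> borel_measurable M"
  shows "(\<lambda>x. \<chi> i. f x i) \<in> borel_measurable M"
  using assms by (subst borel_measurable_vec_iff) simp

lemma borel_measurable_nth:
  fixes f :: "'a \<Rightarrow> real^'n"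
  assumes "f \<in> borel_measurable M"
  shows "(\<lambda>x. f x $ i) \<in> borel_measurable M"
  using assms borel_measurable_vec_iff by blast

lemma borel_measurable_PGD_step:
  assumes S: "convex S" "closed S" "S \<noteq> {}"
    and [measurable]: "x \<in> borel_measurable M" "g \<in> borel_measurable M"
  shows "(\<lambda>\<omega>. PGD_step S \<eta> (x \<omega>) (g \<omega>)) \<in> borel_measurable M"
proof -
  have [measurable]: "closest_point S \<in> borel_measurable borel"
    using continuous_on_closest_point[OF S] by (rule borel_measurable_continuous_onI)
  show ?thesis unfolding PGD_step_def by measurable
qed

lemma borel_measurable_EG_step:
  fixes l g :: "'a \<Rightarrow> real^'m::finite"
  assumes [measurable]: "l \<in> borel_measurable M" "g \<in> borel_measurable M"
  shows "(\<lambda>\<omega>. EG_step \<eta> (l \<omega>) (g \<omega>)) \<in> borel_measurable M"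
proof -
  note [measurable] = borel_measurable_nth[OF assms(1)] borel_measurable_nth[OF assms(2)]
  show ?thesis unfolding EG_step_def by (intro borel_measurable_vec_lambda) measurable
qed

text \<open>The objectives are known to be continuous on \<Theta> only, so composition with an
  iterate is measurable because the iterate takes its values there.\<close>

lemma borel_measurable_continuous_on_compose:
  fixes h :: "'b::topological_space \<Rightarrow> real"
  assumes "continuous_on S h" "x \<in> borel_measurable M" "\<And>\<omega>. \<omega> \<in> space M \<Longrightarrow> x \<omega> \<in> S"
  shows "(\<lambda>\<omega>. h (x \<omega>)) \<in> borel_measurable M"
  using measurable_compose[OF measurable_restrict_space2[of x M S borel]
      borel_measurable_continuous_on_restrict[OF assms(1)]] assms(2,3) by auto

lemma ada_state_cong:
  assumes "\<And>s t. s \<in> {1..n} \<Longrightarrow> t \<in> {1..n} \<Longrightarrow> dominates f (x s) (x t) \<longleftrightarrow> dominates f (y s) (y t)"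
  shows "ada_state f x n = ada_state f y n"
  using assms
proof (induction n)
  case (Suc n)
  then have IH: "ada_state f x n = ada_state f y n" by simp
  obtain P \<gamma> where st: "ada_state f y n = (P, \<gamma>)" by (cases "ada_state f y n")
  then have "P \<subseteq> {1..n}" using ada_state_invariant by blast
  then have "{\<tau>\<in>P. dominates f (x \<tau>) (x (Suc n))} = {\<tau>\<in>P. dominates f (y \<tau>) (y (Suc n))}"
    "{\<tau>\<in>P. dominates f (x (Suc n)) (x \<tau>)} = {\<tau>\<in>P. dominates f (y (Suc n)) (y \<tau>)}"
    using Suc.prems by fastforce+
  then show ?case by (simp only: ada_state.simps IH st Let_def prod.case)
qed simp

text \<open>The adaptive conversion depends on the trajectory only through the dominance relation between
  the iterates, which takes finitely many values; on each of them the output is a fixed linear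
  combination of the iterates.\<close>

lemma borel_measurable_ada_average:
  fixes x :: "nat \<Rightarrow> 'w \<Rightarrow> real^'d" and f :: "'m::finite \<Rightarrow> real^'d \<Rightarrow> real"
  assumes x: "\<And>t. t \<in> {1..T} \<Longrightarrow> x t \<in> borel_measurable M"
    and fx: "\<And>i t. t \<in> {1..T} \<Longrightarrow> (\<lambda>\<omega>. f i (x t \<omega>)) \<in> borel_measurable M"
  shows "(\<lambda>\<omega>. ada_average f T (\<lambda>t. x t \<omega>)) \<in> borel_measurable M"
proof -
  let ?I = "{1..T} \<times> {1..T}"
  define rel where "rel \<omega> = {p \<in> ?I. dominates f (x (fst p) \<omega>) (x (snd p) \<omega>)}" for \<omega>
  \<comment> \<open>A sample point realising the relation r is picked to compute the state. For a
    relation that never occurs the pick is arbitrary, which is harmless: \<open>state\<close> is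
    evaluated at \<open>rel \<omega>\<close>, and its index set lies in {1..T} in any case.\<close>
  define state where "state r = ada_state f (\<lambda>t. x t (SOME \<omega>. rel \<omega> = r)) T" for r
  define avg where "avg r \<omega> = (1 / real T) *\<^sub>R (\<Sum>\<tau>\<in>fst (state r). snd (state r) \<tau> *\<^sub>R x \<tau> \<omega>)" for r \<omega>
  have state: "state (rel \<omega>) = ada_state f (\<lambda>t. x t \<omega>) T" for \<omega>
  proof -
    have "rel (SOME \<omega>'. rel \<omega>' = rel \<omega>) = rel \<omega>" by (rule someI) simp
    then show ?thesis unfolding state_def by (intro ada_state_cong) (auto simp: rel_def set_eq_iff)
  qed
  have "(\<lambda>\<omega>. avg (rel \<omega>) \<omega>) \<in> borel_measurable M"
  proof (rule measurable_compose_countable'[where f = avg and g = rel and I = "Pow ?I"])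
    show "avg r \<in> borel_measurable M" for r
    proof -
      have "fst (state r) \<subseteq> {1..T}"
        using ada_state_invariant[OF prod.collapse[symmetric]] unfolding state_def by blast
      then show ?thesis
        unfolding avg_def using x by (intro borel_measurable_scaleR borel_measurable_const borel_measurable_sum) auto
    qed
    show "rel \<in> measurable M (count_space (Pow ?I))"
    proof (subst measurable_count_space_eq2, simp, intro conjI ballI)
      show "rel \<in> space M \<rightarrow> Pow ?I" by (auto simp: rel_def)
      fix r assume "r \<in> Pow ?I"
      then have eq: "rel -` {r} \<inter> space M
          = {\<omega> \<in> space M. \<forall>p\<in>?I. dominates f (x (fst p) \<omega>) (x (snd p) \<omega>) \<longleftrightarrow> p \<in> r}"
        unfolding rel_def by blast
      have "Measurable.pred M (\<lambda>\<omega>. dominates f (x s \<omega>) (x t \<omega>))" if "s \<in> {1..T}" "t \<in> {1..T}" for s t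
      proof -
        note [measurable] = fx[OF that(1)] fx[OF that(2)]
        show ?thesis unfolding dominates_def by measurable
      qed
      then have *: "Measurable.pred M (\<lambda>\<omega>. dominates f (x (fst p) \<omega>) (x (snd p) \<omega>) \<longleftrightarrow> p \<in> r)" if "p \<in> ?I" for p
        using that by (intro pred_intros_logic) auto
      have "Measurable.pred M (\<lambda>\<omega>. \<forall>p\<in>?I. dominates f (x (fst p) \<omega>) (x (snd p) \<omega>) \<longleftrightarrow> p \<in> r)"
        by (rule pred_intros_finite(3)) (use * in auto)
      then show "rel -` {r} \<inter> space M \<in> sets M"
        unfolding eq by (simp add: pred_def)
    qed
    show "countable (Pow ?I)" by (intro countable_finite) simp
  qed
  moreover have "avg (rel \<omega>) \<omega> = ada_average f T (\<lambda>t. x t \<omega>)" for \<omega>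
    unfolding avg_def state ada_average_def by (simp add: case_prod_unfold Let_def)
  ultimately show ?thesis by simp
qed

section \<open>The Azuma-Hoeffding inequality\<close>

text \<open>Hoeffding's lemma for the symmetric two-point distribution on -x and x, i.e. an interval
  of length 2x with weight 1/2.\<close>

lemma cosh_le_exp_square:
  fixes x :: real
  assumes "0 \<le> x"
  shows "cosh x \<le> exp (x\<^sup>2 / 2)"
proof -
  have "- (2 * x) * (1 / 2) + ln (1 + 1 / 2 * (exp (2 * x) - 1)) \<le> (2 * x)\<^sup>2 / 8"
    using Hoeffdings_lemma_aux[of "2 * x" "1 / 2"] assms by simp
  moreover have "1 + 1 / 2 * (exp (2 * x) - 1) = cosh x * exp x"
    by (simp add: cosh_def algebra_simps flip: exp_add)
  ultimately have "ln (cosh x) \<le> x\<^sup>2 / 2"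
    by (simp add: ln_mult power2_eq_square)
  then have "exp (ln (cosh x)) \<le> exp (x\<^sup>2 / 2)" by (simp only: exp_le_cancel_iff)
  then show ?thesis by simp
qed

text \<open>On [-c, c] the exponential lies below its chord. The bound is affine in x, so a centred
  variable contributes only the constant term.\<close>

lemma exp_le_chord:
  fixes x a c :: real
  assumes "0 < c" "\<bar>x\<bar> \<le> c"
  shows "exp (a * x) \<le> cosh (a * c) + sinh (a * c) / c * x"
proof -
  define p where "p = (x + c) / (2 * c)"
  have p: "0 \<le> p" "p \<le> 1" using assms by (auto simp: p_def field_simps)
  have x: "x = (2 * p - 1) * c" using assms by (simp add: p_def field_simps)
  have "exp (a * x) = exp ((1 - p) *\<^sub>R (- (a * c)) + p *\<^sub>R (a * c))"
    unfolding x by (simp add: algebra_simps)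
  also have "\<dots> \<le> (1 - p) * exp (- (a * c)) + p * exp (a * c)"
    using convex_onD[OF convex_on_exp[of 1], of p "- (a * c)" "a * c"] p by simp
  also have "\<dots> = cosh (a * c) + sinh (a * c) / c * x"
    unfolding x using assms by (simp add: cosh_def sinh_def field_simps)
  finally show ?thesis .
qed

context prob_space
begin

lemma subalgebra_sigma_finite:
  assumes "subalgebra M F"
  shows "sigma_finite_subalgebra M F"
  using finite_measure_subalgebra_is_sigma_finite[of M F] assms
  by (simp add: finite_measure_subalgebra_def finite_measure_subalgebra_axioms_def finite_measure_axioms)

text \<open>Induction on the number of rounds. The chord bound turns the new factor into cosh (a c)
  plus a multiple of the increment, so no conditional expectation of an exponential appears. The
  product of the past exponential with the increment integrates to 0, because the former is
  measurable at time n and the latter has conditional mean 0 there.\<close>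

lemma martingale_difference_mgf:
  fixes X :: "nat \<Rightarrow> 'a \<Rightarrow> real" and F :: "nat \<Rightarrow> 'a measure"
  assumes sub: "\<And>t. t \<le> T \<Longrightarrow> subalgebra M (F t)"
    and mono: "\<And>s t. s \<le> t \<Longrightarrow> t \<le> T \<Longrightarrow> sets (F s) \<subseteq> sets (F t)"
    and meas: "\<And>t. t \<in> {1..T} \<Longrightarrow> X t \<in> borel_measurable (F t)"
    and bound: "\<And>t. t \<in> {1..T} \<Longrightarrow> AE \<omega> in M. \<bar>X t \<omega>\<bar> \<le> c" and c: "0 < c"
    and mart: "\<And>t. t \<in> {1..T} \<Longrightarrow> AE \<omega> in M. real_cond_exp M (F (t - 1)) (X t) \<omega> = 0"
    and a: "0 \<le> a" and n: "n \<le> T"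
  shows "integrable M (\<lambda>\<omega>. exp (a * (\<Sum>t=1..n. X t \<omega>)))
    \<and> expectation (\<lambda>\<omega>. exp (a * (\<Sum>t=1..n. X t \<omega>))) \<le> exp (real n * ((a * c)\<^sup>2 / 2))"
  using n
proof (induction n)
  case 0
  then show ?case by (simp add: prob_space)
next
  case (Suc n)
  let ?E = "\<lambda>n \<omega>. exp (a * (\<Sum>t=1..n. X t \<omega>))"
  have XM: "X t \<in> borel_measurable M" if "t \<in> {1..T}" for t
    using measurable_from_subalg[OF sub meas] that by auto
  have E_bound: "AE \<omega> in M. norm (?E k \<omega>) \<le> exp (a * (real k * c))" if "k \<le> T" for k
  proof -
    have "AE \<omega> in M. \<forall>t\<in>{1..k}. \<bar>X t \<omega>\<bar> \<le> c"
      using bound that by (intro AE_finite_allI) auto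
    then show ?thesis
    proof eventually_elim
      case (elim \<omega>)
      have "(\<Sum>t=1..k. X t \<omega>) \<le> real k * c"
        using sum_bounded_above[of "{1..k}" "\<lambda>t. X t \<omega>" c] elim by force
      then show ?case using a by (simp add: mult_left_mono)
    qed
  qed
  have E_int: "integrable M (?E k)" if "k \<le> T" for k
  proof (rule integrable_const_bound[OF E_bound[OF that]])
    have "(\<lambda>\<omega>. \<Sum>t=1..k. X t \<omega>) \<in> borel_measurable M"
      using that by (intro borel_measurable_sum XM) auto
    then show "?E k \<in> borel_measurable M" by measurable
  qed
  let ?F = "F n" and ?X = "X (Suc n)"
  interpret sigma_finite_subalgebra M ?F
    using Suc.prems by (intro subalgebra_sigma_finite sub) simp
  have E_F: "?E n \<in> borel_measurable ?F"
  proof -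
    have "X t \<in> borel_measurable ?F" if "t \<in> {1..n}" for t
    proof -
      have "subalgebra ?F (F t)"
        using mono[of t n] sub[of n] sub[of t] that Suc.prems by (auto simp: subalgebra_def)
      then show ?thesis using measurable_from_subalg meas[of t] that Suc.prems by auto
    qed
    then have "(\<lambda>\<omega>. \<Sum>t=1..n. X t \<omega>) \<in> borel_measurable ?F" by (intro borel_measurable_sum) auto
    then show ?thesis by measurable
  qed
  have XSuc: "?X \<in> borel_measurable M" using XM Suc.prems by simp
  have prod_int: "integrable M (\<lambda>\<omega>. ?E n \<omega> * ?X \<omega>)"
  proof (rule integrable_const_bound)
    show "AE \<omega> in M. norm (?E n \<omega> * ?X \<omega>) \<le> exp (a * (real n * c)) * c"
    proof -
      have "AE \<omega> in M. norm (?E n \<omega>) \<le> exp (a * (real n * c))" "AE \<omega> in M. \<bar>?X \<omega>\<bar> \<le> c"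
        using E_bound[of n] bound[of "Suc n"] Suc.prems by simp_all
      then show ?thesis
        by eventually_elim (simp add: abs_mult mult_mono)
    qed
    show "(\<lambda>\<omega>. ?E n \<omega> * ?X \<omega>) \<in> borel_measurable M"
      using E_int[of n] XSuc Suc.prems by (intro borel_measurable_times) auto
  qed
  have "expectation (\<lambda>\<omega>. ?E n \<omega> * ?X \<omega>) = expectation (\<lambda>\<omega>. ?E n \<omega> * real_cond_exp M ?F ?X \<omega>)"
    by (rule real_cond_exp_intg(2)[symmetric, OF prod_int E_F XSuc])
  also have "\<dots> = expectation (\<lambda>\<omega>. 0)"
    using mart[of "Suc n"] Suc.prems E_int[of n] measurable_from_subalg[OF subalg borel_measurable_cond_exp]
    by (intro integral_cong_AE) auto
  finally have zero: "expectation (\<lambda>\<omega>. ?E n \<omega> * ?X \<omega>) = 0" by simp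
  have "expectation (?E (Suc n)) \<le> expectation (\<lambda>\<omega>. cosh (a * c) * ?E n \<omega> + sinh (a * c) / c * (?E n \<omega> * ?X \<omega>))"
  proof (rule integral_mono_AE)
    show "AE \<omega> in M. ?E (Suc n) \<omega> \<le> cosh (a * c) * ?E n \<omega> + sinh (a * c) / c * (?E n \<omega> * ?X \<omega>)"
    proof -
      have "AE \<omega> in M. \<bar>?X \<omega>\<bar> \<le> c" using bound[of "Suc n"] Suc.prems by simp
      then show ?thesis
      proof eventually_elim
        case (elim \<omega>)
        have "?E (Suc n) \<omega> = ?E n \<omega> * exp (a * ?X \<omega>)"
          by (simp add: algebra_simps flip: exp_add)
        also have "\<dots> \<le> ?E n \<omega> * (cosh (a * c) + sinh (a * c) / c * ?X \<omega>)"
          using elim c by (intro mult_left_mono exp_le_chord) auto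
        finally show ?case by (simp add: algebra_simps)
      qed
    qed
    show "integrable M (?E (Suc n))" by (rule E_int[OF Suc.prems])
  qed (use E_int[of n] prod_int Suc.prems in auto)
  also have "\<dots> = cosh (a * c) * expectation (?E n)"
    using zero E_int[of n] prod_int Suc.prems by simp
  also have "\<dots> \<le> exp ((a * c)\<^sup>2 / 2) * exp (real n * ((a * c)\<^sup>2 / 2))"
    using Suc a c by (intro mult_mono cosh_le_exp_square) auto
  also have "\<dots> = exp (real (Suc n) * ((a * c)\<^sup>2 / 2))"
    by (simp add: algebra_simps flip: exp_add)
  finally show ?case using E_int[of "Suc n"] Suc.prems by simp
qed

lemma azuma_hoeffding:
  fixes X :: "nat \<Rightarrow> 'a \<Rightarrow> real" and F :: "nat \<Rightarrow> 'a measure"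
  assumes T: "1 \<le> T"
    and sub: "\<And>t. t \<le> T \<Longrightarrow> subalgebra M (F t)"
    and mono: "\<And>s t. s \<le> t \<Longrightarrow> t \<le> T \<Longrightarrow> sets (F s) \<subseteq> sets (F t)"
    and meas: "\<And>t. t \<in> {1..T} \<Longrightarrow> X t \<in> borel_measurable (F t)"
    and bound: "\<And>t. t \<in> {1..T} \<Longrightarrow> AE \<omega> in M. \<bar>X t \<omega>\<bar> \<le> c" and c: "0 < c"
    and mart: "\<And>t. t \<in> {1..T} \<Longrightarrow> AE \<omega> in M. real_cond_exp M (F (t - 1)) (X t) \<omega> = 0"
    and s: "0 \<le> s"
  shows "\<P>(\<omega> in M. s \<le> (\<Sum>t=1..T. X t \<omega>)) \<le> exp (- s\<^sup>2 / (2 * real T * c\<^sup>2))"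
proof (cases "s = 0")
  case True
  then show ?thesis by simp
next
  case False
  \<comment> \<open>The minimiser of the exponent T (a c)^2 / 2 - a s. It is positive only for s >
    0, as the equivalence of the two events requires; at s = 0 the claimed bound is 1.\<close>
  define a where "a = s / (real T * c\<^sup>2)"
  have a: "0 < a" using False s T c by (simp add: a_def)
  let ?E = "\<lambda>\<omega>. exp (a * (\<Sum>t=1..T. X t \<omega>))"
  have mgf: "integrable M ?E" "expectation ?E \<le> exp (real T * ((a * c)\<^sup>2 / 2))"
    using martingale_difference_mgf[where F = F and X = X and T = T and n = T,
        OF sub mono meas bound c mart less_imp_le[OF a] order.refl] by simp_all
  have "(s \<le> (\<Sum>t=1..T. X t \<omega>)) = (exp (a * s) \<le> ?E \<omega>)" for \<omega>
    using a by simp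
  then have "\<P>(\<omega> in M. s \<le> (\<Sum>t=1..T. X t \<omega>)) = \<P>(\<omega> in M. exp (a * s) \<le> ?E \<omega>)" by (simp only:)
  also have "\<dots> \<le> expectation ?E / exp (a * s)"
    by (rule integral_Markov_inequality_measure[where A = "space M"]) (use mgf in auto)
  also have "\<dots> \<le> exp (real T * ((a * c)\<^sup>2 / 2)) / exp (a * s)"
    by (intro divide_right_mono mgf) simp
  also have "\<dots> = exp (real T * ((a * c)\<^sup>2 / 2) - a * s)" by (simp add: exp_diff)
  also have "real T * ((a * c)\<^sup>2 / 2) - a * s = - s\<^sup>2 / (2 * real T * c\<^sup>2)"
    using T c by (simp add: a_def field_simps power2_eq_square)
  finally show ?thesis .
qed

text \<open>The shape of every scalar piece of the noise: a predictable factor h times the deviation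
  of an estimate Y from its conditional mean. As Y is merely integrable, it is the boundedness of h
  that makes the product integrable and lets h be pulled out.\<close>

lemma cond_exp_centred:
  assumes sub: "subalgebra M F" and h: "h \<in> borel_measurable F" "\<And>\<omega>. \<omega> \<in> space M \<Longrightarrow> \<bar>h \<omega>\<bar> \<le> K"
    and Y: "integrable M Y"
  shows "integrable M (\<lambda>\<omega>. h \<omega> * (real_cond_exp M F Y \<omega> - Y \<omega>))"
    and "AE \<omega> in M. real_cond_exp M F (\<lambda>\<omega>. h \<omega> * (real_cond_exp M F Y \<omega> - Y \<omega>)) \<omega> = 0"
proof -
  interpret sigma_finite_subalgebra M F by (rule subalgebra_sigma_finite[OF sub])
  have hM: "h \<in> borel_measurable M" by (rule measurable_from_subalg[OF sub h(1)])
  let ?N = "\<lambda>\<omega>. real_cond_exp M F Y \<omega> - Y \<omega>"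
  have N: "integrable M ?N" using Y real_cond_exp_int(1)[OF Y] by simp
  show int: "integrable M (\<lambda>\<omega>. h \<omega> * ?N \<omega>)"
  proof (rule Bochner_Integration.integrable_bound)
    show "integrable M (\<lambda>\<omega>. K * ?N \<omega>)" using N by simp
    show "AE \<omega> in M. norm (h \<omega> * ?N \<omega>) \<le> norm (K * ?N \<omega>)"
    proof (rule AE_I2)
      fix \<omega> assume "\<omega> \<in> space M"
      from h(2)[OF this] have "\<bar>h \<omega>\<bar> \<le> \<bar>K\<bar>" by linarith
      then show "norm (h \<omega> * ?N \<omega>) \<le> norm (K * ?N \<omega>)"
        unfolding real_norm_def abs_mult by (rule mult_right_mono) simp
    qed
  qed (use hM N in auto)
  have "AE \<omega> in M. real_cond_exp M F ?N \<omega> = 0"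
    using real_cond_exp_diff[OF real_cond_exp_int(1)[OF Y] Y]
      real_cond_exp_F_meas[OF real_cond_exp_int(1)[OF Y] borel_measurable_cond_exp]
    by eventually_elim simp
  moreover have "AE \<omega> in M. real_cond_exp M F (\<lambda>\<omega>. h \<omega> * ?N \<omega>) \<omega> = h \<omega> * real_cond_exp M F ?N \<omega>"
    using N int h(1) by (intro real_cond_exp_mult) auto
  ultimately show "AE \<omega> in M. real_cond_exp M F (\<lambda>\<omega>. h \<omega> * ?N \<omega>) \<omega> = 0"
    by eventually_elim simp
qed

lemma cond_exp_sum_zero:
  fixes Y :: "'i \<Rightarrow> 'a \<Rightarrow> real"
  assumes sub: "subalgebra M F" and Y: "\<And>i. integrable M (Y i)"
    and zero: "\<And>i. AE \<omega> in M. real_cond_exp M F (Y i) \<omega> = 0" and I: "finite I"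
  shows "AE \<omega> in M. real_cond_exp M F (\<lambda>\<omega>. \<Sum>i\<in>I. Y i \<omega>) \<omega> = 0"
proof -
  interpret sigma_finite_subalgebra M F by (rule subalgebra_sigma_finite[OF sub])
  have "AE \<omega> in M. \<forall>i\<in>I. real_cond_exp M F (Y i) \<omega> = 0"
    using zero I by (intro AE_finite_allI) auto
  with real_cond_exp_sum[of Y I, OF Y] show ?thesis by eventually_elim simp
qed

end

section \<open>The filtration generated by the batches\<close>

lemma subalgebra_batch_history:
  assumes "\<And>t i. t \<in> {1..n} \<Longrightarrow> batch t i \<in> measurable M (Z i)"
  shows "subalgebra M (batch_history M Z batch n)"
proof -
  have "{batch s i -` A \<inter> space M | s i A. s \<in> {1..n} \<and> A \<in> sets (Z i)} \<subseteq> sets M"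
    using assms measurable_sets by blast
  then show ?thesis
    unfolding subalgebra_def batch_history_def
    by (simp add: space_measure_of_conv sets.sigma_sets_subset sets_measure_of_conv)
qed

lemma space_batch_history: "space (batch_history M Z batch n) = space M"
  by (simp add: batch_history_def space_measure_of_conv)

lemma sets_batch_history_mono:
  assumes "s \<le> t"
  shows "sets (batch_history M Z batch s) \<subseteq> sets (batch_history M Z batch t)"
  unfolding batch_history_def
  by (subst (1 2) sets_measure_of) (use assms in \<open>force intro!: sigma_sets_mono'\<close>)+

section \<open>Stochastic mirror descent on the Tchebycheff scalarization\<close>

text \<open>The weights w are at most 1 and those of l add up to 1, so the mixed gradient obeys the
  same bound as the single ones, with no factor for the number of objectives.\<close>

lemma convex_combination_prob_simplex:
  fixes l w :: "real^'m::finite" and z :: "'m \<Rightarrow> real^'d"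
  assumes l: "l \<in> prob_simplex" and w: "w \<in> prob_simplex" and z: "\<And>i. infnorm (z i) \<le> c" and c: "0 \<le> c"
  shows "infnorm (\<Sum>i\<in>UNIV. (l $ i * w $ i) *\<^sub>R z i) \<le> c"
proof (rule infnorm_le_cart)
  fix j
  note nn = prob_simplex_nonneg[OF l] prob_simplex_nonneg[OF w]
  have "\<bar>(\<Sum>i\<in>UNIV. (l $ i * w $ i) *\<^sub>R z i) $ j\<bar> \<le> (\<Sum>i\<in>UNIV. l $ i * w $ i * \<bar>z i $ j\<bar>)"
    using nn by (simp add: sum_component) (rule order.trans[OF sum_abs], simp add: abs_mult)
  also have "\<dots> \<le> (\<Sum>i\<in>UNIV. l $ i * c)"
  proof (rule sum_mono)
    fix i
    have "l $ i * w $ i * \<bar>z i $ j\<bar> \<le> l $ i * 1 * c"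
      using nn[of i] prob_simplex_le_one[OF w] component_le_infnorm_cart[of "z i" j] z[of i]
      by (intro mult_mono) (auto intro: order.trans)
    then show "l $ i * w $ i * \<bar>z i $ j\<bar> \<le> l $ i * c" by simp
  qed
  also have "\<dots> = c" using sum_prob_simplex[OF l] by (simp flip: sum_distrib_right)
  finally show "\<bar>(\<Sum>i\<in>UNIV. (l $ i * w $ i) *\<^sub>R z i) $ j\<bar> \<le> c" .
qed

text \<open>Rounds are numbered from 1, so index 0 is padding and indices 0 and 1 both return the
  start. The value at round t uses the noise of earlier rounds only, which makes the ghost
  predictable.\<close>

primrec ghost :: "('a \<Rightarrow> 'b \<Rightarrow> 'a) \<Rightarrow> 'a \<Rightarrow> (nat \<Rightarrow> 'b) \<Rightarrow> nat \<Rightarrow> 'a" where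
  "ghost step a e 0 = a"
| "ghost step a e (Suc n) = (if n = 0 then a else step (ghost step a e n) (e n))"

lemma ghost_one: "ghost step a e 1 = a"
  and ghost_step: "1 \<le> t \<Longrightarrow> ghost step a e (t + 1) = step (ghost step a e t) (e t)"
  by simp_all

text \<open>One run with arbitrary step sizes. Feasibility, adaptedness, the noise estimates and the
  associated constants hold for all of them; the prescribed values enter with the gap bound.\<close>

locale omd_tch = prob_space M
  for M :: "'w measure" +
  fixes \<Theta> :: "(real^'d) set"
    and f :: "'m::finite \<Rightarrow> real^'d \<Rightarrow> real"
    and w :: "real^'m"
    and U L R\<theta> :: real
    and T :: nat
    and Z :: "'m \<Rightarrow> 'b measure"
    and batch :: "nat \<Rightarrow> 'm \<Rightarrow> 'w \<Rightarrow> 'b"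
    and \<delta>f :: "nat \<Rightarrow> 'm \<Rightarrow> 'w \<Rightarrow> real^'d"
    and fh :: "nat \<Rightarrow> 'm \<Rightarrow> 'w \<Rightarrow> real"
    and \<theta> g\<theta> :: "nat \<Rightarrow> 'w \<Rightarrow> real^'d"
    and l gl :: "nat \<Rightarrow> 'w \<Rightarrow> real^'m"
    and \<theta>1 :: "real^'d"
    and \<eta>\<theta> \<eta>l :: real
  assumes T: "1 \<le> T"
    and Theta: "closed \<Theta>" "convex \<Theta>"
    and w: "w \<in> prob_simplex"
    and pos: "0 < U" "0 < L" "0 < R\<theta>"
    and f_diff: "\<And>i x. x \<in> \<Theta> \<Longrightarrow> f i differentiable (at x)"
    and f_nonneg: "\<And>i x. x \<in> \<Theta> \<Longrightarrow> 0 \<le> f i x"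
    and f_convex: "\<And>i. convex_on \<Theta> (f i)"
    and f_le: "\<And>i x. x \<in> \<Theta> \<Longrightarrow> f i x \<le> U"
    and f_grad: "\<And>i x. x \<in> \<Theta> \<Longrightarrow> infnorm (grad (f i) x) \<le> L"
    and Theta_bound: "\<And>x. x \<in> \<Theta> \<Longrightarrow> infnorm x \<le> R\<theta>"
    and batch: "\<And>t i. t \<in> {1..T} \<Longrightarrow> batch t i \<in> measurable M (Z i)"
    and \<delta>f_adapted: "\<And>t i. t \<in> {1..T} \<Longrightarrow> \<delta>f t i \<in> borel_measurable (batch_history M Z batch t)"
    and fh_adapted: "\<And>t i. t \<in> {1..T} \<Longrightarrow> fh t i \<in> borel_measurable (batch_history M Z batch t)"
    and \<delta>f_integrable: "\<And>t i. t \<in> {1..T} \<Longrightarrow> integrable M (\<delta>f t i)"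
    and fh_integrable: "\<And>t i. t \<in> {1..T} \<Longrightarrow> integrable M (fh t i)"
    and \<delta>f_unbiased: "\<And>t i j. t \<in> {1..T} \<Longrightarrow>
           AE \<omega> in M. real_cond_exp M (batch_history M Z batch (t - 1)) (\<lambda>\<omega>. \<delta>f t i \<omega> $ j) \<omega>
                      = grad (f i) (\<theta> t \<omega>) $ j"
    and fh_unbiased: "\<And>t i. t \<in> {1..T} \<Longrightarrow>
           AE \<omega> in M. real_cond_exp M (batch_history M Z batch (t - 1)) (fh t i) \<omega>
                      = f i (\<theta> t \<omega>)"
    and g\<theta>: "\<And>t \<omega>. t \<in> {1..T} \<Longrightarrow> \<omega> \<in> space M \<Longrightarrow>
           g\<theta> t \<omega> = est_grad_theta w (l t \<omega>) (\<lambda>i. \<delta>f t i \<omega>)"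
    and gl: "\<And>t \<omega>. t \<in> {1..T} \<Longrightarrow> \<omega> \<in> space M \<Longrightarrow>
           gl t \<omega> = est_grad_lambda w (\<lambda>i. fh t i \<omega>)"
    and g\<theta>_bound: "\<And>t. t \<in> {1..T} \<Longrightarrow> AE \<omega> in M. infnorm (g\<theta> t \<omega>) \<le> L"
    and gl_bound: "\<And>t. t \<in> {1..T} \<Longrightarrow> AE \<omega> in M. infnorm (gl t \<omega>) \<le> U"
    and \<theta>1: "\<theta>1 \<in> \<Theta>"
    and \<theta>_init: "\<And>\<omega>. \<omega> \<in> space M \<Longrightarrow> \<theta> 1 \<omega> = \<theta>1"
    and l_init: "\<And>\<omega>. \<omega> \<in> space M \<Longrightarrow> l 1 \<omega> = (\<chi> i. 1 / real CARD('m))"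
    and \<theta>_step: "\<And>t \<omega>. t \<in> {1..T} \<Longrightarrow> \<omega> \<in> space M \<Longrightarrow>
           \<theta> (t + 1) \<omega> = PGD_step \<Theta> \<eta>\<theta> (\<theta> t \<omega>) (g\<theta> t \<omega>)"
    and l_step: "\<And>t \<omega>. t \<in> {1..T} \<Longrightarrow> \<omega> \<in> space M \<Longrightarrow>
           l (t + 1) \<omega> = EG_step \<eta>l (l t \<omega>) (gl t \<omega>)"
begin

abbreviation F :: "nat \<Rightarrow> 'w measure" where
  "F \<equiv> batch_history M Z batch"

text \<open>The exact gradients, as versions of conditional expectations: unlike
  \<open>\<lambda>\<omega>. grad (f i) (\<theta> t \<omega>)\<close> they are measurable by construction.\<close>

definition G\<theta> :: "nat \<Rightarrow> 'w \<Rightarrow> real^'d" where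
  "G\<theta> t \<omega> = est_grad_theta w (l t \<omega>) (\<lambda>i. \<chi> j. real_cond_exp M (F (t - 1)) (\<lambda>\<omega>. \<delta>f t i \<omega> $ j) \<omega>)"

definition Gl :: "nat \<Rightarrow> 'w \<Rightarrow> real^'m" where
  "Gl t \<omega> = est_grad_lambda w (\<lambda>i. real_cond_exp M (F (t - 1)) (fh t i) \<omega>)"

definition ghost\<theta> :: "nat \<Rightarrow> 'w \<Rightarrow> real^'d" where
  "ghost\<theta> t \<omega> = ghost (PGD_step \<Theta> \<eta>\<theta>) \<theta>1 (\<lambda>t. G\<theta> t \<omega> - g\<theta> t \<omega>) t"

definition ghostl :: "nat \<Rightarrow> 'w \<Rightarrow> real^'m" where
  "ghostl t \<omega> = ghost (EG_step \<eta>l) (\<chi> i. 1 / real CARD('m)) (\<lambda>t. Gl t \<omega> - gl t \<omega>) t"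

text \<open>The remainder of the regret decomposition. The second difference is ghost minus iterate
  because the \<lambda>-player maximises. No comparator is left in it.\<close>

definition noise :: "nat \<Rightarrow> 'w \<Rightarrow> real" where
  "noise t \<omega> = (G\<theta> t \<omega> - g\<theta> t \<omega>) \<bullet> (\<theta> t \<omega> - ghost\<theta> t \<omega>) + (Gl t \<omega> - gl t \<omega>) \<bullet> (ghostl t \<omega> - l t \<omega>)"

lemma ghost\<theta>_one: "ghost\<theta> 1 \<omega> = \<theta>1"
  and ghostl_one: "ghostl 1 \<omega> = (\<chi> i. 1 / real CARD('m))"
  unfolding ghost\<theta>_def ghostl_def by (simp_all only: ghost_one)

lemma ghost\<theta>_step: "t \<in> {1..T} \<Longrightarrow> ghost\<theta> (t + 1) \<omega> = PGD_step \<Theta> \<eta>\<theta> (ghost\<theta> t \<omega>) (G\<theta> t \<omega> - g\<theta> t \<omega>)"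
  and ghostl_step: "t \<in> {1..T} \<Longrightarrow> ghostl (t + 1) \<omega> = EG_step \<eta>l (ghostl t \<omega>) (Gl t \<omega> - gl t \<omega>)"
  unfolding ghost\<theta>_def ghostl_def by (simp_all only: ghost_step atLeastAtMost_iff)

lemma subalgebra_F: "n \<le> T \<Longrightarrow> subalgebra M (F n)"
  using batch by (intro subalgebra_batch_history) auto

lemma measurable_F_mono: "s \<le> t \<Longrightarrow> h \<in> measurable (F s) N \<Longrightarrow> h \<in> measurable (F t) N"
  using sets_batch_history_mono[of s t M Z batch] measurable_from_subalg[of "F t" "F s"]
  by (auto simp: subalgebra_def space_batch_history)

lemma measurable_F: "n \<le> T \<Longrightarrow> h \<in> measurable (F n) N \<Longrightarrow> h \<in> measurable M N"
  by (rule measurable_from_subalg[OF subalgebra_F])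

context
  fixes \<omega>
  assumes \<omega>: "\<omega> \<in> space M"
begin

text \<open>Feasibility of iterates and ghosts holds at every sample point, since a step lands in
  the feasible set whatever the gradient; the gradient bounds hold only almost surely.\<close>

lemma \<theta>_in: "t \<in> {1..T} \<Longrightarrow> \<theta> t \<omega> \<in> \<Theta>"
  by (rule PGD_path_in[where x = "\<lambda>t. \<theta> t \<omega>" and T = T, OF Theta(1) _ \<theta>_step[OF _ \<omega>]]) (auto simp: \<theta>_init[OF \<omega>, simplified] \<theta>1)

lemma ghost\<theta>_in: "t \<in> {1..T} \<Longrightarrow> ghost\<theta> t \<omega> \<in> \<Theta>"
  by (rule PGD_path_in[where x = "\<lambda>t. ghost\<theta> t \<omega>" and T = T, OF Theta(1) _ ghost\<theta>_step])
     (auto simp: ghost\<theta>_one[simplified] \<theta>1)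

lemma l_in: "t \<in> {1..T} \<Longrightarrow> l t \<omega> \<in> pos_simplex"
  by (rule EG_path_pos_simplex[where l = "\<lambda>t. l t \<omega>" and T = T, OF l_init[OF \<omega>] l_step[OF _ \<omega>]]) auto

lemma ghostl_in: "t \<in> {1..T} \<Longrightarrow> ghostl t \<omega> \<in> pos_simplex"
  by (rule EG_path_pos_simplex[where l = "\<lambda>t. ghostl t \<omega>" and T = T, OF ghostl_one ghostl_step]) auto

end

text \<open>The shift by one is what matters: iterates and ghosts of round t are known from the
  batches up to t - 1, the estimates of round t from those up to t.\<close>

lemma iterates_adapted:
  assumes "1 \<le> t" "t \<le> T"
  shows "\<theta> t \<in> borel_measurable (F (t - 1)) \<and> l t \<in> borel_measurable (F (t - 1))
    \<and> ghost\<theta> t \<in> borel_measurable (F (t - 1)) \<and> ghostl t \<in> borel_measurable (F (t - 1))"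
    and "g\<theta> t \<in> borel_measurable (F t)" "gl t \<in> borel_measurable (F t)"
    and "G\<theta> t \<in> borel_measurable (F (t - 1))" "Gl t \<in> borel_measurable (F (t - 1))"
proof -
  \<comment> \<open>An implication in \<open>l t\<close>, so that it serves inside the induction as
    well as after it.\<close>
  have g: "g\<theta> t \<in> borel_measurable (F t) \<and> gl t \<in> borel_measurable (F t)
      \<and> G\<theta> t \<in> borel_measurable (F (t - 1)) \<and> Gl t \<in> borel_measurable (F (t - 1))"
    if t: "t \<in> {1..T}" and l: "l t \<in> borel_measurable (F (t - 1))" for t
  proof (intro conjI)
    have lt: "l t \<in> borel_measurable (F t)" by (rule measurable_F_mono[OF _ l]) simp
    note [measurable] = borel_measurable_nth[OF l] borel_measurable_nth[OF lt] \<delta>f_adapted[OF t] fh_adapted[OF t]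
    have "(\<lambda>\<omega>. est_grad_theta w (l t \<omega>) (\<lambda>i. \<delta>f t i \<omega>)) \<in> borel_measurable (F t)"
      unfolding est_grad_theta_def by measurable
    then show "g\<theta> t \<in> borel_measurable (F t)"
      using g\<theta>[OF t] by (subst measurable_cong) (auto simp: space_batch_history)
    have "(\<lambda>\<omega>. est_grad_lambda w (\<lambda>i. fh t i \<omega>)) \<in> borel_measurable (F t)"
      unfolding est_grad_lambda_def by (intro borel_measurable_vec_lambda) measurable
    then show "gl t \<in> borel_measurable (F t)"
      using gl[OF t] by (subst measurable_cong) (auto simp: space_batch_history)
    have [measurable]: "(\<lambda>\<omega>. \<chi> j. real_cond_exp M (F (t - 1)) (\<lambda>\<omega>. \<delta>f t i \<omega> $ j) \<omega>) \<in> borel_measurable (F (t - 1))" for i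
      by (intro borel_measurable_vec_lambda borel_measurable_cond_exp)
    show "G\<theta> t \<in> borel_measurable (F (t - 1))"
      unfolding G\<theta>_def[abs_def] est_grad_theta_def by measurable
    show "Gl t \<in> borel_measurable (F (t - 1))"
      unfolding Gl_def[abs_def] est_grad_lambda_def by (intro borel_measurable_vec_lambda) measurable
  qed
  have *: "\<theta> t \<in> borel_measurable (F (t - 1)) \<and> l t \<in> borel_measurable (F (t - 1))
    \<and> ghost\<theta> t \<in> borel_measurable (F (t - 1)) \<and> ghostl t \<in> borel_measurable (F (t - 1))"
    if "1 \<le> t" "t \<le> T" for t
    using that
  proof (induction t rule: dec_induct)
    case base
    have "h \<in> borel_measurable (F 0)" if "\<And>\<omega>. \<omega> \<in> space M \<Longrightarrow> h \<omega> = c" for h :: "'w \<Rightarrow> real^'k" and c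
      using that by (subst measurable_cong[of _ _ "\<lambda>_. c"]) (auto simp: space_batch_history)
    from this[OF \<theta>_init] this[OF l_init] this[OF ghost\<theta>_one] this[OF ghostl_one] show ?case by simp
  next
    case (step t)
    then have t: "t \<in> {1..T}" and IH: "\<theta> t \<in> borel_measurable (F (t - 1))" "l t \<in> borel_measurable (F (t - 1))"
      "ghost\<theta> t \<in> borel_measurable (F (t - 1))" "ghostl t \<in> borel_measurable (F (t - 1))" by auto
    note IH' = IH[THEN measurable_F_mono[of "t - 1" t, rotated], simplified]
    have gs: "g\<theta> t \<in> borel_measurable (F t)" "gl t \<in> borel_measurable (F t)"
      and "G\<theta> t \<in> borel_measurable (F (t - 1))" "Gl t \<in> borel_measurable (F (t - 1))"
      using g[OF t IH(2)] by auto
    then have Gs: "G\<theta> t \<in> borel_measurable (F t)" "Gl t \<in> borel_measurable (F t)"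
      using measurable_F_mono[of "t - 1" t] by auto
    have "\<theta> (t + 1) \<in> borel_measurable (F t)"
      using \<theta>_step[OF t] \<theta>1 Theta IH' gs
      by (subst measurable_cong[of _ _ "\<lambda>\<omega>. PGD_step \<Theta> \<eta>\<theta> (\<theta> t \<omega>) (g\<theta> t \<omega>)"])
         (auto simp: space_batch_history intro!: borel_measurable_PGD_step)
    moreover have "l (t + 1) \<in> borel_measurable (F t)"
      using l_step[OF t] IH' gs
      by (subst measurable_cong[of _ _ "\<lambda>\<omega>. EG_step \<eta>l (l t \<omega>) (gl t \<omega>)"])
         (auto simp: space_batch_history intro!: borel_measurable_EG_step)
    moreover have "ghost\<theta> (t + 1) \<in> borel_measurable (F t)"
      using ghost\<theta>_step[OF t] \<theta>1 Theta IH' gs Gs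
      by (subst measurable_cong[of _ _ "\<lambda>\<omega>. PGD_step \<Theta> \<eta>\<theta> (ghost\<theta> t \<omega>) (G\<theta> t \<omega> - g\<theta> t \<omega>)"])
         (auto simp: space_batch_history intro!: borel_measurable_PGD_step)
    moreover have "ghostl (t + 1) \<in> borel_measurable (F t)"
      using ghostl_step[OF t] IH' gs Gs
      by (subst measurable_cong[of _ _ "\<lambda>\<omega>. EG_step \<eta>l (ghostl t \<omega>) (Gl t \<omega> - gl t \<omega>)"])
         (auto simp: space_batch_history intro!: borel_measurable_EG_step)
    ultimately show ?case by simp
  qed
  note * = *[OF assms]
  from * show "\<theta> t \<in> borel_measurable (F (t - 1)) \<and> l t \<in> borel_measurable (F (t - 1))
    \<and> ghost\<theta> t \<in> borel_measurable (F (t - 1)) \<and> ghostl t \<in> borel_measurable (F (t - 1))" .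
  from g[of t] * assms show "g\<theta> t \<in> borel_measurable (F t)" "gl t \<in> borel_measurable (F t)"
    "G\<theta> t \<in> borel_measurable (F (t - 1))" "Gl t \<in> borel_measurable (F (t - 1))" by auto
qed

lemma noise_adapted:
  assumes t: "t \<in> {1..T}"
  shows "noise t \<in> borel_measurable (F t)"
proof -
  have "\<theta> t \<in> borel_measurable (F t)" "l t \<in> borel_measurable (F t)" "ghost\<theta> t \<in> borel_measurable (F t)"
    "ghostl t \<in> borel_measurable (F t)" "G\<theta> t \<in> borel_measurable (F t)" "Gl t \<in> borel_measurable (F t)"
    using iterates_adapted[of t] t measurable_F_mono[of "t - 1" t] by auto
  moreover have "g\<theta> t \<in> borel_measurable (F t)" "gl t \<in> borel_measurable (F t)"
    using iterates_adapted(2,3)[of t] t by auto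
  ultimately show ?thesis
    unfolding noise_def[abs_def]
    by (intro borel_measurable_add borel_measurable_inner borel_measurable_diff)
qed

lemma continuous_on_objective: "continuous_on \<Theta> (f i)"
  using f_diff differentiable_imp_continuous_within continuous_at_imp_continuous_on by blast

lemma infnorm_est_grad_theta_le:
  assumes "p \<in> prob_simplex" "x \<in> \<Theta>"
  shows "infnorm (est_grad_theta w p (\<lambda>i. grad (f i) x)) \<le> L"
  unfolding est_grad_theta_def
  using f_grad[OF assms(2)] pos by (intro convex_combination_prob_simplex assms w) auto

lemma infnorm_est_grad_lambda_le:
  assumes "x \<in> \<Theta>"
  shows "infnorm (est_grad_lambda w (\<lambda>i. f i x)) \<le> U"
proof (rule infnorm_le_cart)
  fix i
  have "w $ i * f i x \<le> 1 * U"
    using prob_simplex_le_one[OF w] prob_simplex_nonneg[OF w] f_le[OF assms] f_nonneg[OF assms]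
    by (intro mult_mono) auto
  then show "\<bar>est_grad_lambda w (\<lambda>i. f i x) $ i\<bar> \<le> U"
    using prob_simplex_nonneg[OF w, of i] f_nonneg[OF assms, of i] by (simp add: est_grad_lambda_def)
qed

text \<open>Unbiasedness gives one null set per objective and coordinate; these are finitely many,
  so a single null set suffices for the vector identities.\<close>

lemma exact_gradients:
  assumes t: "t \<in> {1..T}"
  shows "AE \<omega> in M. G\<theta> t \<omega> = est_grad_theta w (l t \<omega>) (\<lambda>i. grad (f i) (\<theta> t \<omega>))
    \<and> Gl t \<omega> = est_grad_lambda w (\<lambda>i. f i (\<theta> t \<omega>))
    \<and> infnorm (G\<theta> t \<omega>) \<le> L \<and> infnorm (Gl t \<omega>) \<le> U"
proof -
  have "AE \<omega> in M. \<forall>i\<in>UNIV. \<forall>j\<in>UNIV. real_cond_exp M (F (t - 1)) (\<lambda>\<omega>. \<delta>f t i \<omega> $ j) \<omega> = grad (f i) (\<theta> t \<omega>) $ j"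
    using \<delta>f_unbiased[OF t] by (intro AE_finite_allI) auto
  moreover have "AE \<omega> in M. \<forall>i\<in>UNIV. real_cond_exp M (F (t - 1)) (fh t i) \<omega> = f i (\<theta> t \<omega>)"
    using fh_unbiased[OF t] by (intro AE_finite_allI) auto
  ultimately show ?thesis using AE_space
  proof eventually_elim
    case (elim \<omega>)
    note \<theta> = \<theta>_in[OF elim(3) t] and l = pos_simplexD(1)[OF l_in[OF elim(3) t]]
    have G: "G\<theta> t \<omega> = est_grad_theta w (l t \<omega>) (\<lambda>i. grad (f i) (\<theta> t \<omega>))"
      "Gl t \<omega> = est_grad_lambda w (\<lambda>i. f i (\<theta> t \<omega>))"
      using elim unfolding G\<theta>_def Gl_def by (simp_all add: vec_nth_inverse)
    show ?case
      using infnorm_est_grad_theta_le[OF l \<theta>] infnorm_est_grad_lambda_le[OF \<theta>] G by simp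
  qed
qed

text \<open>The PGD divergence is half a squared distance, hence at most d (2R)^2 / 2. For EG the
  entropy gradient at the uniform point is a constant vector, orthogonal to differences of simplex
  points, so the divergence is \<open>psi_EG ls\<close> + ln m, and the negative entropy is at most
  0. Of the optimality of the comparators only feasibility enters, so \<theta>hat is
  arbitrary.\<close>

lemma associated_constants_PGD_EG:
  "AE \<omega> in M. associated_constants \<Theta> f w U L T psi_PGD psi_EG
     (\<lambda>t. \<theta> t \<omega>) (\<lambda>t. l t \<omega>) (\<lambda>t. g\<theta> t \<omega>) (\<lambda>t. gl t \<omega>) (\<theta>hat \<omega>)
     1 1 (2 * real CARD('d) * R\<theta>\<^sup>2) (ln (real CARD('m))) (real CARD('d)) 1"
proof -
  have "AE \<omega> in M. \<forall>t\<in>{1..T}. infnorm (g\<theta> t \<omega>) \<le> L \<and> infnorm (gl t \<omega>) \<le> U"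
    using g\<theta>_bound gl_bound by (intro AE_finite_allI AE_conjI) auto
  then show ?thesis using AE_space
  proof eventually_elim
    case (elim \<omega>)
    note \<omega> = elim(2)
    show ?case
      unfolding associated_constants_def
    proof (intro conjI strongly_convex_psi_PGD strongly_convex_psi_EG allI impI ballI)
      fix \<theta>s assume "is_arg_min (\<lambda>x. Lag f w x (time_average T (\<lambda>t. l t \<omega>))) (\<lambda>x. x \<in> \<Theta>) \<theta>s"
      then have \<theta>s: "\<theta>s \<in> \<Theta>" by (simp add: is_arg_min_def)
      have "bregman psi_PGD \<theta>s \<theta>1 = (norm (\<theta>s - \<theta>1))\<^sup>2 / 2"
        unfolding bregman_def grad_psi_PGD psi_PGD_def power2_norm_eq_inner
        by (simp add: algebra_simps inner_commute)
      moreover have "(norm (\<theta>s - \<theta>1))\<^sup>2 \<le> real CARD('d) * (2 * R\<theta>)\<^sup>2"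
        by (intro norm_sq_le_infnorm_bound infnorm_diff_le Theta_bound \<theta>s \<theta>1)
      ultimately show "bregman psi_PGD \<theta>s (\<theta> 1 \<omega>) \<le> 2 * real CARD('d) * R\<theta>\<^sup>2"
        unfolding \<theta>_init[OF \<omega>] by (simp add: power_mult_distrib)
    next
      fix ls assume "is_arg_max (\<lambda>y. Lag f w (\<theta>hat \<omega>) y) (\<lambda>y. y \<in> prob_simplex) ls"
      then have ls: "ls \<in> prob_simplex" by (simp add: is_arg_max_def)
      let ?m = "real CARD('m)"
      let ?u = "\<chi> i. 1 / ?m :: real^'m"
      have grad: "grad psi_EG ?u = (\<chi> i. ln (1 / ?m) + 1)"
        by (subst grad_psi_EG) auto
      have "psi_EG ?u = ln (1 / ?m)" by (simp add: psi_EG_def)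
      moreover have "grad psi_EG ?u \<bullet> (ls - ?u) = 0"
        using sum_prob_simplex[OF ls] unfolding grad
        by (simp add: inner_vec_def sum_subtractf flip: sum_distrib_left)
      ultimately have "bregman psi_EG ls ?u = psi_EG ls + ln ?m"
        unfolding bregman_def by (simp add: ln_div)
      then show "bregman psi_EG ls (l 1 \<omega>) \<le> ln ?m"
        unfolding l_init[OF \<omega>] using psi_EG_nonpos[OF ls] by simp
    next
      fix t assume t: "t \<in> {1..T}"
      note \<theta> = \<theta>_in[OF \<omega> t] and l = pos_simplexD(1)[OF l_in[OF \<omega> t]]
      show "(norm (grad (\<lambda>x. Lag f w x (l t \<omega>)) (\<theta> t \<omega>)))\<^sup>2 \<le> real CARD('d) * L\<^sup>2"
        unfolding grad_Lag_theta[of f, OF f_diff[OF \<theta>]]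
        using norm_sq_le_infnorm_bound[OF infnorm_est_grad_theta_le[OF l \<theta>]] by (simp add: est_grad_theta_def)
      show "(norm (g\<theta> t \<omega>))\<^sup>2 \<le> real CARD('d) * L\<^sup>2"
        using elim t by (intro norm_sq_le_infnorm_bound) auto
      show "(infnorm (grad (Lag f w (\<theta> t \<omega>)) (l t \<omega>)))\<^sup>2 \<le> 1 * U\<^sup>2"
        using power_mono[OF infnorm_est_grad_lambda_le[OF \<theta>] infnorm_pos_le, of 2]
        by (simp add: grad_Lag_lambda est_grad_lambda_def)
      show "(infnorm (gl t \<omega>))\<^sup>2 \<le> 1 * U\<^sup>2"
        using elim t power_mono[of "infnorm (gl t \<omega>)" U 2] by (simp add: infnorm_pos_le)
    qed
  qed
qed

text \<open>The pairing of the supremum norm with the L1 norm: 2L against an L1 diameter of at most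
  2dR for \<Theta>, and 2U against the L1 diameter bound 2 of the simplex.\<close>

lemma noise_bound:
  assumes t: "t \<in> {1..T}"
  shows "AE \<omega> in M. \<bar>noise t \<omega>\<bar> \<le> 4 * (real CARD('d) * R\<theta> * L + U)"
  using exact_gradients[OF t] g\<theta>_bound[OF t] gl_bound[OF t] AE_space
proof eventually_elim
  case (elim \<omega>)
  note \<omega> = elim(4)
  have "\<bar>(G\<theta> t \<omega> - g\<theta> t \<omega>) \<bullet> (\<theta> t \<omega> - ghost\<theta> t \<omega>)\<bar>
      \<le> infnorm (G\<theta> t \<omega> - g\<theta> t \<omega>) * norm_L1 (\<theta> t \<omega> - ghost\<theta> t \<omega>)"
    by (rule inner_le_infnorm_norm_L1)
  also have "\<dots> \<le> (2 * L) * (real CARD('d) * (2 * R\<theta>))"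
    using elim pos
    by (intro mult_mono norm_L1_le_infnorm infnorm_diff_le Theta_bound \<theta>_in[OF \<omega> t] ghost\<theta>_in[OF \<omega> t] norm_L1_nonneg) auto
  finally have 1: "\<bar>(G\<theta> t \<omega> - g\<theta> t \<omega>) \<bullet> (\<theta> t \<omega> - ghost\<theta> t \<omega>)\<bar> \<le> 4 * (real CARD('d) * R\<theta> * L)"
    by (simp add: algebra_simps)
  have "\<bar>(Gl t \<omega> - gl t \<omega>) \<bullet> (ghostl t \<omega> - l t \<omega>)\<bar> \<le> infnorm (Gl t \<omega> - gl t \<omega>) * norm_L1 (ghostl t \<omega> - l t \<omega>)"
    by (rule inner_le_infnorm_norm_L1)
  also have "\<dots> \<le> (2 * U) * 2"
    using elim pos
    by (intro mult_mono norm_L1_prob_simplex_diff infnorm_diff_le pos_simplexD(1) l_in[OF \<omega> t] ghostl_in[OF \<omega> t] norm_L1_nonneg) auto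
  finally show ?case using 1 unfolding noise_def by (simp add: algebra_simps)
qed

text \<open>Conditional expectation is scalar here, so the inner products are expanded:
  \<open>A\<close> runs over objectives and coordinates of \<theta>, \<open>B\<close> over
  objectives. Each piece is a bounded predictable factor times a centred estimate.\<close>

lemma noise_martingale:
  assumes t: "t \<in> {1..T}"
  shows "AE \<omega> in M. real_cond_exp M (F (t - 1)) (noise t) \<omega> = 0"
proof -
  let ?F = "F (t - 1)" and ?CE = "real_cond_exp M (F (t - 1))"
  have sub: "subalgebra M ?F" using t by (intro subalgebra_F) auto
  interpret sigma_finite_subalgebra M ?F by (rule subalgebra_sigma_finite[OF sub])
  define A where "A i j \<omega> = ((\<theta> t \<omega> - ghost\<theta> t \<omega>) $ j * (l t \<omega> $ i * w $ i))
      * (?CE (\<lambda>\<omega>. \<delta>f t i \<omega> $ j) \<omega> - \<delta>f t i \<omega> $ j)" for i j \<omega>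
  define B where "B i \<omega> = ((ghostl t \<omega> - l t \<omega>) $ i * w $ i) * (?CE (fh t i) \<omega> - fh t i \<omega>)" for i \<omega>
  have meas: "\<theta> t \<in> borel_measurable ?F" "l t \<in> borel_measurable ?F" "ghost\<theta> t \<in> borel_measurable ?F" "ghostl t \<in> borel_measurable ?F"
    using iterates_adapted(1)[of t] t by auto
  note [measurable] = meas[THEN borel_measurable_nth]
  note w01 = prob_simplex_nonneg[OF w] prob_simplex_le_one[OF w]
  have A: "integrable M (A i j)" "AE \<omega> in M. ?CE (A i j) \<omega> = 0" for i j
  proof -
    have h: "(\<lambda>\<omega>. (\<theta> t \<omega> - ghost\<theta> t \<omega>) $ j * (l t \<omega> $ i * w $ i)) \<in> borel_measurable ?F"
      unfolding vector_minus_component by measurable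
    have h_le: "\<bar>(\<theta> t \<omega> - ghost\<theta> t \<omega>) $ j * (l t \<omega> $ i * w $ i)\<bar> \<le> (2 * R\<theta>) * (1 * 1)" if \<omega>: "\<omega> \<in> space M" for \<omega>
    proof -
      have "\<bar>\<theta> t \<omega> $ j\<bar> \<le> R\<theta>" "\<bar>ghost\<theta> t \<omega> $ j\<bar> \<le> R\<theta>"
        using Theta_bound[OF \<theta>_in[OF \<omega> t]] Theta_bound[OF ghost\<theta>_in[OF \<omega> t]] component_le_infnorm_cart order.trans by blast+
      then show ?thesis
        unfolding abs_mult vector_minus_component using w01[of i] pos
          prob_simplex_nonneg[OF pos_simplexD(1)[OF l_in[OF \<omega> t]], of i] prob_simplex_le_one[OF pos_simplexD(1)[OF l_in[OF \<omega> t]], of i]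
        by (intro mult_mono) auto
    qed
    have Y: "integrable M (\<lambda>\<omega>. \<delta>f t i \<omega> $ j)"
      using integrable_bounded_linear[OF bounded_linear_vec_nth \<delta>f_integrable[OF t]] .
    show "integrable M (A i j)" "AE \<omega> in M. ?CE (A i j) \<omega> = 0"
      using cond_exp_centred[OF sub h h_le Y] unfolding A_def[abs_def] by simp_all
  qed
  have B: "integrable M (B i)" "AE \<omega> in M. ?CE (B i) \<omega> = 0" for i
  proof -
    have h: "(\<lambda>\<omega>. (ghostl t \<omega> - l t \<omega>) $ i * w $ i) \<in> borel_measurable ?F"
      unfolding vector_minus_component by measurable
    have h_le: "\<bar>(ghostl t \<omega> - l t \<omega>) $ i * w $ i\<bar> \<le> 1 * 1" if \<omega>: "\<omega> \<in> space M" for \<omega>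
      unfolding abs_mult vector_minus_component using w01[of i]
        prob_simplex_nonneg[OF pos_simplexD(1)[OF l_in[OF \<omega> t]], of i] prob_simplex_le_one[OF pos_simplexD(1)[OF l_in[OF \<omega> t]], of i]
        prob_simplex_nonneg[OF pos_simplexD(1)[OF ghostl_in[OF \<omega> t]], of i] prob_simplex_le_one[OF pos_simplexD(1)[OF ghostl_in[OF \<omega> t]], of i]
      by (intro mult_mono) auto
    show "integrable M (B i)" "AE \<omega> in M. ?CE (B i) \<omega> = 0"
      using cond_exp_centred[OF sub h h_le fh_integrable[OF t]] unfolding B_def[abs_def] by simp_all
  qed
  have AA: "integrable M (\<lambda>\<omega>. \<Sum>p\<in>UNIV. A (fst p) (snd p) \<omega>)" using A(1) by auto
  have BB: "integrable M (\<lambda>\<omega>. \<Sum>i\<in>UNIV. B i \<omega>)" using B(1) by auto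
  have eq: "noise t \<omega> = (\<Sum>p\<in>UNIV. A (fst p) (snd p) \<omega>) + (\<Sum>i\<in>UNIV. B i \<omega>)" if \<omega>: "\<omega> \<in> space M" for \<omega>
  proof -
    have "G\<theta> t \<omega> - g\<theta> t \<omega> = (\<Sum>i\<in>UNIV. (l t \<omega> $ i * w $ i) *\<^sub>R ((\<chi> j. ?CE (\<lambda>\<omega>. \<delta>f t i \<omega> $ j) \<omega>) - \<delta>f t i \<omega>))"
      unfolding G\<theta>_def g\<theta>[OF t \<omega>] est_grad_theta_def by (simp add: sum_subtractf scaleR_diff_right)
    then have "(G\<theta> t \<omega> - g\<theta> t \<omega>) \<bullet> (\<theta> t \<omega> - ghost\<theta> t \<omega>) = (\<Sum>i\<in>UNIV. \<Sum>j\<in>UNIV. A i j \<omega>)"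
      by (simp only: inner_sum_left inner_scaleR_left)
         (simp add: A_def inner_vec_def sum_distrib_left mult_ac)
    also have "\<dots> = (\<Sum>p\<in>UNIV. A (fst p) (snd p) \<omega>)"
      by (simp add: sum.cartesian_product case_prod_unfold)
    finally show ?thesis
      unfolding noise_def Gl_def gl[OF t \<omega>] est_grad_lambda_def B_def
      by (simp add: inner_vec_def algebra_simps)
  qed
  have "AE \<omega> in M. ?CE (noise t) \<omega> = ?CE (\<lambda>\<omega>. (\<Sum>p\<in>UNIV. A (fst p) (snd p) \<omega>) + (\<Sum>i\<in>UNIV. B i \<omega>)) \<omega>"
    using eq AA BB measurable_F[OF _ noise_adapted[OF t]] t
    by (intro real_cond_exp_cong AE_I2) auto
  moreover note real_cond_exp_add[OF AA BB]
    cond_exp_sum_zero[OF sub, of "\<lambda>p. A (fst p) (snd p)" UNIV, OF A finite]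
    cond_exp_sum_zero[OF sub, of B UNIV, OF B finite]
  ultimately show ?thesis by eventually_elim simp
qed

lemma gap_le:
  assumes \<eta>\<theta>: "\<eta>\<theta> = sqrt (8 * R\<theta>\<^sup>2 / (5 * real T * L\<^sup>2))"
    and \<eta>l: "\<eta>l = sqrt (4 * ln (real CARD('m)) / (5 * real T * U\<^sup>2))"
    and avg: "\<And>\<omega>. \<omega> \<in> space M \<Longrightarrow> averages_at_most \<Theta> f T (\<lambda>t. \<theta> t \<omega>) (\<theta>hat \<omega>)"
  shows "AE \<omega> in M. \<forall>y\<in>\<Theta>. real T * (TCH f w (\<theta>hat \<omega>) - TCH f w y)
    \<le> sqrt (real T) * (2 * sqrt 10 * real CARD('d) * R\<theta> * L + 2 * sqrt 5 * sqrt (ln (real CARD('m))) * U)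
      + (\<Sum>t=1..T. noise t \<omega>)"
proof -
  have "AE \<omega> in M. \<forall>t\<in>{1..T}. infnorm (g\<theta> t \<omega>) \<le> L \<and> infnorm (gl t \<omega>) \<le> U"
    using g\<theta>_bound gl_bound by (intro AE_finite_allI AE_conjI) auto
  moreover have "AE \<omega> in M. \<forall>t\<in>{1..T}. G\<theta> t \<omega> = est_grad_theta w (l t \<omega>) (\<lambda>i. grad (f i) (\<theta> t \<omega>))
    \<and> Gl t \<omega> = est_grad_lambda w (\<lambda>i. f i (\<theta> t \<omega>))
    \<and> infnorm (G\<theta> t \<omega>) \<le> L \<and> infnorm (Gl t \<omega>) \<le> U"
    by (intro AE_finite_allI exact_gradients) auto
  ultimately show ?thesis using AE_space
  proof eventually_elim
    case (elim \<omega>)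
    note \<omega> = elim(3)
    note \<theta> = \<theta>_in[OF \<omega>] and l = pos_simplexD(1)[OF l_in[OF \<omega>]]
    have grads: "infnorm (g\<theta> t \<omega>) \<le> L" "infnorm (G\<theta> t \<omega>) \<le> L" "infnorm (gl t \<omega>) \<le> U" "infnorm (Gl t \<omega>) \<le> U"
      if "t \<in> {1..T}" for t
      using elim(1,2) that by blast+
    show ?case
    proof
      fix y assume y: "y \<in> \<Theta>"
      \<comment> \<open>The maximising index varies with the sample point, so the regret bound is
        applied pointwise with whichever index occurs.\<close>
      have "TCH f w (\<theta>hat \<omega>) \<in> range (\<lambda>i. w $ i * f i (\<theta>hat \<omega>))"
        unfolding TCH_def by (rule Max_in) auto
      then obtain i where i: "TCH f w (\<theta>hat \<omega>) = w $ i * f i (\<theta>hat \<omega>)" by blast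
      have le_TCH: "w $ j * f j y \<le> TCH f w y" for j
        unfolding TCH_def by (rule Max_ge) auto
      have step: "w $ i * f i (\<theta> t \<omega>) - TCH f w y
          \<le> G\<theta> t \<omega> \<bullet> (\<theta> t \<omega> - y) + (Gl t \<omega> $ i - Gl t \<omega> \<bullet> l t \<omega>)" if t: "t \<in> {1..T}" for t
      proof -
        note nn = prob_simplex_nonneg[OF l[OF t]] prob_simplex_nonneg[OF w]
        have "f j (\<theta> t \<omega>) - grad (f j) (\<theta> t \<omega>) \<bullet> (\<theta> t \<omega> - y) \<le> f j y" for j
          using convex_on_above_tangent[OF f_convex \<theta>[OF t] y GDERIV_grad[OF f_diff[OF \<theta>[OF t]]], of j]
          by (simp add: inner_diff_right)
        then have "(\<Sum>j\<in>UNIV. l t \<omega> $ j * w $ j * (f j (\<theta> t \<omega>) - grad (f j) (\<theta> t \<omega>) \<bullet> (\<theta> t \<omega> - y)))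
            \<le> (\<Sum>j\<in>UNIV. l t \<omega> $ j * (w $ j * f j y))"
          using nn unfolding mult.assoc by (intro sum_mono mult_left_mono) auto
        \<comment> \<open>A \<lambda>-average of the weighted objectives is at most their maximum:
          the Lagrangian at y never exceeds \<open>TCH f w y\<close>.\<close>
        also have "\<dots> \<le> (\<Sum>j\<in>UNIV. l t \<omega> $ j * TCH f w y)"
          by (intro sum_mono mult_left_mono le_TCH nn)
        also have "\<dots> = TCH f w y"
          using sum_prob_simplex[OF l[OF t]] by (simp flip: sum_distrib_right)
        finally have "Gl t \<omega> \<bullet> l t \<omega> - G\<theta> t \<omega> \<bullet> (\<theta> t \<omega> - y) \<le> TCH f w y"
          using elim(2) t
          by (simp add: est_grad_theta_def est_grad_lambda_def inner_vec_def[of "vec_lambda _"] inner_sum_left sum_subtractf right_diff_distrib mult_ac)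
        then show ?thesis using elim(2) t by (simp add: est_grad_lambda_def)
      qed
      have "real T * (TCH f w (\<theta>hat \<omega>) - TCH f w y) \<le> (\<Sum>t=1..T. w $ i * f i (\<theta> t \<omega>) - TCH f w y)"
      proof -
        have "w $ i * (real T * f i (\<theta>hat \<omega>)) \<le> w $ i * (\<Sum>t=1..T. f i (\<theta> t \<omega>))"
          using avg[OF \<omega>] prob_simplex_nonneg[OF w] unfolding averages_at_most_def by (intro mult_left_mono) auto
        then show ?thesis unfolding i by (simp add: sum_subtractf sum_distrib_left algebra_simps)
      qed
      also have "\<dots> \<le> (\<Sum>t=1..T. G\<theta> t \<omega> \<bullet> (\<theta> t \<omega> - y) + (Gl t \<omega> $ i - Gl t \<omega> \<bullet> l t \<omega>))"
        by (intro sum_mono step)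
      also have "\<dots> \<le> sqrt (real T) * (2 * sqrt 10 * real CARD('d) * R\<theta> * L + 2 * sqrt 5 * sqrt (ln (real CARD('m))) * U)
          + (\<Sum>t=1..T. (G\<theta> t \<omega> - g\<theta> t \<omega>) \<bullet> (\<theta> t \<omega> - ghost\<theta> t \<omega>) + (Gl t \<omega> - gl t \<omega>) \<bullet> (ghostl t \<omega> - l t \<omega>))"
        by (rule saddle_regret[where S = \<Theta> and x = "\<lambda>t. \<theta> t \<omega>" and u = "\<lambda>t. ghost\<theta> t \<omega>"
              and l = "\<lambda>t. l t \<omega>" and v = "\<lambda>t. ghostl t \<omega>" and g = "\<lambda>t. g\<theta> t \<omega>" and G = "\<lambda>t. G\<theta> t \<omega>"
              and gl = "\<lambda>t. gl t \<omega>" and Gl = "\<lambda>t. Gl t \<omega>",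
              OF T Theta(2,1) _ _ y Theta_bound pos \<eta>\<theta> \<eta>l l_init[OF \<omega>] ghostl_one
                \<theta>_step[OF _ \<omega>] ghost\<theta>_step l_step[OF _ \<omega>] ghostl_step grads])
           (simp_all only: \<theta>_init[OF \<omega>] ghost\<theta>_one \<theta>1)
      finally show "real T * (TCH f w (\<theta>hat \<omega>) - TCH f w y)
          \<le> sqrt (real T) * (2 * sqrt 10 * real CARD('d) * R\<theta> * L + 2 * sqrt 5 * sqrt (ln (real CARD('m))) * U)
            + (\<Sum>t=1..T. noise t \<omega>)"
        unfolding noise_def .
    qed
  qed
qed

lemma TCH_gap_high_probability:
  assumes \<eta>\<theta>: "\<eta>\<theta> = sqrt (8 * R\<theta>\<^sup>2 / (5 * real T * L\<^sup>2))"
    and \<eta>l: "\<eta>l = sqrt (4 * ln (real CARD('m)) / (5 * real T * U\<^sup>2))"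
    and avg: "\<And>\<omega>. \<omega> \<in> space M \<Longrightarrow> averages_at_most \<Theta> f T (\<lambda>t. \<theta> t \<omega>) (\<theta>hat \<omega>)"
    and \<theta>hat: "\<theta>hat \<in> borel_measurable M"
    and \<gamma>: "0 < \<gamma>" "\<gamma> < 1"
  shows "\<P>(\<omega> in M. TCH f w (\<theta>hat \<omega>) - (INF x\<in>\<Theta>. TCH f w x)
      \<le> 2 * sqrt 10 * real CARD('d) * R\<theta> * L / sqrt (real T)
        + 2 * sqrt 5 * sqrt (ln (real CARD('m))) * U / sqrt (real T)
        + 4 * (real CARD('d) * R\<theta> * L + U) * sqrt (2 / real T * ln (1 / \<gamma>))) \<ge> 1 - \<gamma>"
    (is "\<P>(\<omega> in M. ?gap \<omega> \<le> ?bound) \<ge> _")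
proof -
  define c where "c = 4 * (real CARD('d) * R\<theta> * L + U)"
  define reg where "reg = 2 * sqrt 10 * real CARD('d) * R\<theta> * L + 2 * sqrt 5 * sqrt (ln (real CARD('m))) * U"
  \<comment> \<open>The level at which the Azuma-Hoeffding tail exp (-s^2 / (2 T c^2)) equals
    \<gamma>.\<close>
  define s where "s = c * sqrt (2 * real T * ln (1 / \<gamma>))"
  have T0: "0 < real T" using T by simp
  have c: "0 < c" using pos by (auto simp: c_def intro!: add_nonneg_pos)
  have ln\<gamma>: "0 < ln (1 / \<gamma>)" using \<gamma> by simp
  have s: "0 \<le> s" using c ln\<gamma> T0 by (simp add: s_def)
  have sT: "sqrt (real T) * sqrt (real T) = real T" by simp
  have bound: "?bound = (sqrt (real T) * reg + s) / real T"
  proof -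
    have "sqrt (2 / real T * ln (1 / \<gamma>)) = sqrt (2 * real T * ln (1 / \<gamma>)) / real T"
    proof (rule real_sqrt_unique)
      show "(sqrt (2 * real T * ln (1 / \<gamma>)) / real T)\<^sup>2 = 2 / real T * ln (1 / \<gamma>)"
        using T0 ln\<gamma> by (simp add: power_divide power2_eq_square[of "real T"])
    qed (use ln\<gamma> in simp)
    moreover have "a / sqrt (real T) = sqrt (real T) * a / real T" for a
      using T0 sT by (simp add: divide_simps)
    ultimately show ?thesis
      unfolding s_def c_def reg_def by (simp add: add_divide_distrib distrib_left)
  qed
  have f\<theta>hat [measurable]: "(\<lambda>\<omega>. f i (\<theta>hat \<omega>)) \<in> borel_measurable M" for i
    using borel_measurable_continuous_on_compose[OF continuous_on_objective \<theta>hat] avg by (auto simp: averages_at_most_def)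
  have good: "{\<omega> \<in> space M. ?gap \<omega> \<le> ?bound} \<in> sets M"
  proof -
    \<comment> \<open>The infimum is a constant and the maximum is over finitely many objectives, so
      the event is a finite intersection of measurable sets and its probability is
      meaningful.\<close>
    have "(?gap \<omega> \<le> ?bound) = (\<forall>i. w $ i * f i (\<theta>hat \<omega>) \<le> ?bound + (INF x\<in>\<Theta>. TCH f w x))" for \<omega>
      unfolding diff_le_eq TCH_def by (subst Max_le_iff) auto
    then show ?thesis by simp
  qed
  have noiseM: "noise t \<in> borel_measurable M" if "t \<in> {1..T}" for t
    using measurable_F[OF _ noise_adapted[OF that]] that by auto
  have sumM [measurable]: "(\<lambda>\<omega>. \<Sum>t=1..T. noise t \<omega>) \<in> borel_measurable M"
    by (intro borel_measurable_sum noiseM)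
  have "\<P>(\<omega> in M. s \<le> (\<Sum>t=1..T. noise t \<omega>)) \<le> exp (- s\<^sup>2 / (2 * real T * c\<^sup>2))"
    by (rule azuma_hoeffding[where F = F and X = noise and c = c,
          OF T subalgebra_F sets_batch_history_mono noise_adapted noise_bound[folded c_def] c noise_martingale s])
  also have "- s\<^sup>2 / (2 * real T * c\<^sup>2) = ln \<gamma>"
  proof -
    have "s\<^sup>2 = c\<^sup>2 * (2 * real T * ln (1 / \<gamma>))"
      using T0 ln\<gamma> unfolding s_def power_mult_distrib by (subst real_sqrt_pow2) auto
    then show ?thesis using T0 c \<gamma> by (simp add: ln_div)
  qed
  also have "exp (ln \<gamma>) = \<gamma>" using \<gamma> by simp
  finally have "1 - \<gamma> \<le> 1 - \<P>(\<omega> in M. s \<le> (\<Sum>t=1..T. noise t \<omega>))" by simp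
  also have "\<dots> = \<P>(\<omega> in M. \<not> s \<le> (\<Sum>t=1..T. noise t \<omega>))"
    by (rule prob_neg[symmetric]) measurable
  also have "\<dots> \<le> \<P>(\<omega> in M. ?gap \<omega> \<le> ?bound)"
  proof (rule finite_measure_mono_AE[OF _ good])
    show "AE \<omega> in M. \<omega> \<in> {\<omega> \<in> space M. \<not> s \<le> (\<Sum>t=1..T. noise t \<omega>)} \<longrightarrow> \<omega> \<in> {\<omega> \<in> space M. ?gap \<omega> \<le> ?bound}"
    proof -
      have "AE \<omega> in M. \<forall>y\<in>\<Theta>. real T * (TCH f w (\<theta>hat \<omega>) - TCH f w y)
          \<le> sqrt (real T) * reg + (\<Sum>t=1..T. noise t \<omega>)"
        unfolding reg_def by (rule gap_le[OF \<eta>\<theta> \<eta>l avg])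
      then show ?thesis
      proof eventually_elim
        case (elim \<omega>)
        show ?case
        proof (intro impI CollectI conjI)
          assume *: "\<omega> \<in> {\<omega> \<in> space M. \<not> s \<le> (\<Sum>t=1..T. noise t \<omega>)}"
          have "TCH f w (\<theta>hat \<omega>) - ?bound \<le> (INF x\<in>\<Theta>. TCH f w x)"
          proof (rule cINF_greatest)
            fix y assume "y \<in> \<Theta>"
            with elim * have "real T * (TCH f w (\<theta>hat \<omega>) - TCH f w y) \<le> sqrt (real T) * reg + s" by force
            then have "TCH f w (\<theta>hat \<omega>) - TCH f w y \<le> ?bound"
              unfolding bound using T0 by (simp add: pos_le_divide_eq mult.commute)
            then show "TCH f w (\<theta>hat \<omega>) - ?bound \<le> TCH f w y" by linarith
          qed (use \<theta>1 in auto)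
          then show "?gap \<omega> \<le> ?bound" by linarith
        qed auto
      qed
    qed
  qed
  finally show ?thesis .
qed

end

theorem corollary3p5:
  fixes \<Theta> :: "(real^'d) set"
    and f :: "'m::finite \<Rightarrow> real^'d \<Rightarrow> real"
    and w :: "real^'m"
    and U L R\<theta> :: real
    and T :: nat
    and M :: "'w measure"
    and Z :: "'m \<Rightarrow> 'b measure"
    and batch :: "nat \<Rightarrow> 'm \<Rightarrow> 'w \<Rightarrow> 'b"
    and \<delta>f :: "nat \<Rightarrow> 'm \<Rightarrow> 'w \<Rightarrow> real^'d"
    and fh :: "nat \<Rightarrow> 'm \<Rightarrow> 'w \<Rightarrow> real"
    and \<theta> g\<theta> :: "nat \<Rightarrow> 'w \<Rightarrow> real^'d"
    and l gl :: "nat \<Rightarrow> 'w \<Rightarrow> real^'m"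
    and \<theta>1 :: "real^'d"
    and \<eta>\<theta> \<eta>l :: real
    and \<theta>hat :: "'w \<Rightarrow> real^'d"
  assumes T: "1 \<le> T"
    and Theta: "\<Theta> \<noteq> {}" "closed \<Theta>" "convex \<Theta>"
    and w: "w \<in> prob_simplex"
    and pos: "0 < U" "0 < L" "0 < R\<theta>"
    and f_diff: "\<And>i x. x \<in> \<Theta> \<Longrightarrow> f i differentiable (at x)"
    and f_nonneg: "\<And>i x. x \<in> \<Theta> \<Longrightarrow> 0 \<le> f i x"
    and f_convex: "\<And>i. convex_on \<Theta> (f i)"
    and f_le: "\<And>i x. x \<in> \<Theta> \<Longrightarrow> f i x \<le> U"
    and f_grad: "\<And>i x. x \<in> \<Theta> \<Longrightarrow> infnorm (grad (f i) x) \<le> L"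
    and Theta_bound: "\<And>x. x \<in> \<Theta> \<Longrightarrow> infnorm x \<le> R\<theta>"
    \<comment> \<open>stochastic gradients\<close>
    and M: "prob_space M"
    and batch: "\<And>t i. t \<in> {1..T} \<Longrightarrow> batch t i \<in> measurable M (Z i)"
    and \<delta>f_adapted: "\<And>t i. t \<in> {1..T} \<Longrightarrow> \<delta>f t i \<in> borel_measurable (batch_history M Z batch t)"
    and fh_adapted: "\<And>t i. t \<in> {1..T} \<Longrightarrow> fh t i \<in> borel_measurable (batch_history M Z batch t)"
    and \<delta>f_integrable: "\<And>t i. t \<in> {1..T} \<Longrightarrow> integrable M (\<delta>f t i)"
    and fh_integrable: "\<And>t i. t \<in> {1..T} \<Longrightarrow> integrable M (fh t i)"
    and \<delta>f_unbiased: "\<And>t i j. t \<in> {1..T} \<Longrightarrow>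
           AE \<omega> in M. real_cond_exp M (batch_history M Z batch (t - 1)) (\<lambda>\<omega>. \<delta>f t i \<omega> $ j) \<omega>
                      = grad (f i) (\<theta> t \<omega>) $ j"
    and fh_unbiased: "\<And>t i. t \<in> {1..T} \<Longrightarrow>
           AE \<omega> in M. real_cond_exp M (batch_history M Z batch (t - 1)) (fh t i) \<omega>
                      = f i (\<theta> t \<omega>)"
    and g\<theta>: "\<And>t \<omega>. t \<in> {1..T} \<Longrightarrow> \<omega> \<in> space M \<Longrightarrow>
           g\<theta> t \<omega> = est_grad_theta w (l t \<omega>) (\<lambda>i. \<delta>f t i \<omega>)"
    and gl: "\<And>t \<omega>. t \<in> {1..T} \<Longrightarrow> \<omega> \<in> space M \<Longrightarrow>
           gl t \<omega> = est_grad_lambda w (\<lambda>i. fh t i \<omega>)"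
    and g\<theta>_bound: "\<And>t. t \<in> {1..T} \<Longrightarrow> AE \<omega> in M. infnorm (g\<theta> t \<omega>) \<le> L"
    and gl_bound: "\<And>t. t \<in> {1..T} \<Longrightarrow> AE \<omega> in M. infnorm (gl t \<omega>) \<le> U"
    \<comment> \<open>updates\<close>
    and \<theta>1: "\<theta>1 \<in> \<Theta>"
    and \<theta>_init: "\<And>\<omega>. \<omega> \<in> space M \<Longrightarrow> \<theta> 1 \<omega> = \<theta>1"
    and l_init: "\<And>\<omega>. \<omega> \<in> space M \<Longrightarrow> l 1 \<omega> = (\<chi> i. 1 / real CARD('m))"
    and \<theta>_step: "\<And>t \<omega>. t \<in> {1..T} \<Longrightarrow> \<omega> \<in> space M \<Longrightarrow>
           \<theta> (t + 1) \<omega> = PGD_step \<Theta> \<eta>\<theta> (\<theta> t \<omega>) (g\<theta> t \<omega>)"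
    and l_step: "\<And>t \<omega>. t \<in> {1..T} \<Longrightarrow> \<omega> \<in> space M \<Longrightarrow>
           l (t + 1) \<omega> = EG_step \<eta>l (l t \<omega>) (gl t \<omega>)"
    \<comment> \<open>output: uniform or adaptive conversion\<close>
    and out: "(\<forall>\<omega>\<in>space M. \<theta>hat \<omega> = time_average T (\<lambda>t. \<theta> t \<omega>)) \<or>
              (\<forall>\<omega>\<in>space M. \<theta>hat \<omega> = ada_average f T (\<lambda>t. \<theta> t \<omega>))"
  shows "(AE \<omega> in M. associated_constants \<Theta> f w U L T psi_PGD psi_EG
             (\<lambda>t. \<theta> t \<omega>) (\<lambda>t. l t \<omega>) (\<lambda>t. g\<theta> t \<omega>) (\<lambda>t. gl t \<omega>) (\<theta>hat \<omega>)
             1 1 (2 * real CARD('d) * R\<theta>\<^sup>2) (ln (real CARD('m))) (real CARD('d)) 1) \<and>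
         (\<eta>\<theta> = sqrt (8 * R\<theta>\<^sup>2 / (5 * real T * L\<^sup>2)) \<and>
          \<eta>l = sqrt (4 * ln (real CARD('m)) / (5 * real T * U\<^sup>2)) \<longrightarrow>
          (\<forall>\<gamma>. 0 < \<gamma> \<and> \<gamma> < 1 \<longrightarrow>
             \<P>(\<omega> in M. TCH f w (\<theta>hat \<omega>) - (INF x\<in>\<Theta>. TCH f w x)
                  \<le> 2 * sqrt 10 * real CARD('d) * R\<theta> * L / sqrt (real T)
                    + 2 * sqrt 5 * sqrt (ln (real CARD('m))) * U / sqrt (real T)
                    + 4 * (real CARD('d) * R\<theta> * L + U) * sqrt (2 / real T * ln (1 / \<gamma>)))
               \<ge> 1 - \<gamma>))"
proof -
  interpret run: omd_tch M \<Theta> f w U L R\<theta> T Z batch \<delta>f fh \<theta> g\<theta> l gl \<theta>1 \<eta>\<theta> \<eta>l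
    by (intro omd_tch.intro M omd_tch_axioms.intro) (fact assms)+
  \<comment> \<open>From here on both conversions are covered by one property; beyond it, only
    measurability of the output still distinguishes them.\<close>
  have avg: "averages_at_most \<Theta> f T (\<lambda>t. \<theta> t \<omega>) (\<theta>hat \<omega>)" if "\<omega> \<in> space M" for \<omega>
  proof -
    have "averages_at_most \<Theta> f T (\<lambda>t. \<theta> t \<omega>) (time_average T (\<lambda>t. \<theta> t \<omega>))"
      "averages_at_most \<Theta> f T (\<lambda>t. \<theta> t \<omega>) (ada_average f T (\<lambda>t. \<theta> t \<omega>))"
      by (rule averages_at_most_time_average averages_at_most_ada_average; fact T Theta f_convex run.\<theta>_in[OF that])+
    then show ?thesis using out that by metis
  qed
  have \<theta>_meas: "\<theta> t \<in> borel_measurable M" if "t \<in> {1..T}" for t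
    by (rule run.measurable_F[of "t - 1"]) (use run.iterates_adapted(1)[of t] that in auto)
  have f\<theta>: "(\<lambda>\<omega>. f i (\<theta> t \<omega>)) \<in> borel_measurable M" if "t \<in> {1..T}" for i t
    by (rule borel_measurable_continuous_on_compose[OF run.continuous_on_objective \<theta>_meas[OF that] run.\<theta>_in[OF _ that]])
  have "(\<lambda>\<omega>. time_average T (\<lambda>t. \<theta> t \<omega>)) \<in> borel_measurable M"
    unfolding time_average_def using \<theta>_meas
    by (intro borel_measurable_scaleR borel_measurable_const borel_measurable_sum) auto
  moreover have "(\<lambda>\<omega>. ada_average f T (\<lambda>t. \<theta> t \<omega>)) \<in> borel_measurable M"
    by (intro borel_measurable_ada_average \<theta>_meas f\<theta>)
  ultimately have "\<theta>hat \<in> borel_measurable M"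
    using out by (auto cong: measurable_cong)
  then show ?thesis
    by (intro conjI impI allI run.associated_constants_PGD_EG run.TCH_gap_high_probability avg) auto
qed

end
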